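(* Let $X\subseteq\mathbb{R}^d$ be the closure of a bounded open set, $c(x,y)=\|x-y\|^2$, and $\varepsilon>0$. Let $\mu\in\mathcal{P}(X)$ and let $\dot\mu\in\mathcal{H}_{\mu,0}^*$. Then: 1. the mean $\dot m=\langle\dot\mu,\mathrm{id}\rangle$ exists in $\mathbb{R}^d$ and is characterized by $P_{\mathcal{S}_\mu}(\dot\mu)=-\mathrm{div}(\dot m\,\mu)$; 2. there holds $\mathbf{g}_\mu(\dot\mu,\dot\mu)=\|\dot m\|^2+\mathbf{g}_\mu\big(\dot\mu+\mathrm{div}(\dot m\mu),\,\dot\mu+\mathrm{div}(\dot m\mu)\big)$.
   Context: $\mathcal{P}(X)$: Radon probability measures. $f_{\mu,\mu}\in C(X)$ is the unique function with $\int_X\exp\left(\frac1\varepsilon(f_{\mu,\mu}(x)+f_{\mu,\mu}(y)-c(x,y))\right)d\mu(x)=1$ for all $y\in X$, and $k_\mu(x,y)=\exp\left(\frac1\varepsilon(f_{\mu,\mu}(x)+f_{\mu,\mu}(y)-c(x,y))\right)$. $\mathcal{H}_\mu$ is the reproducing kernel Hilbert space of $k_\mu$; it contains the constants and embeds continuously in $C^1(X)$. $\mathcal{H}_{\mu,0}^*=\{\sigma\in\mathcal{H}_\mu^*:\langle\sigma,1_X\rangle=0\}$ is the dual of $\mathcal{H}_\mu/\mathbb{R}$ (quotient by constants). $K_\mu[\phi](y)=\int_X\phi(x)k_\mu(x,y)\,d\mu(x)$, $H_\mu[\sigma](y)=\langle\sigma,k_\mu(\cdot,y)\rangle$ (Riesz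 isometry $\mathcal{H}_\mu^*\to\mathcal{H}_\mu$). $\mathrm{id}-K_\mu^2$ is boundedly invertible on $\mathcal{H}_\mu/\mathbb{R}$, and for $\sigma_1,\sigma_2\in\mathcal{H}_{\mu,0}^*$ $$\mathbf{g}_\mu(\sigma_1,\sigma_2)=\frac\varepsilon2\langle\sigma_1,(\mathrm{id}-K_\mu^2)^{-1}H_\mu[\sigma_2]\rangle,$$ which is an inner product on $\mathcal{H}_{\mu,0}^*$ whose norm is equivalent to the dual norm. For $v\in\mathbb{R}^d$, $-\mathrm{div}(v\mu)\in\mathcal{H}_{\mu,0}^*$ is the functional $\phi\mapsto\int_X v\cdot\nabla\phi\,d\mu$. $\mathcal{S}_\mu=\{-\mathrm{div}(v\mu):v\in\mathbb{R}^d\}\subseteq\mathcal{H}_{\mu,0}^*$, and $P_{\mathcal{S}_\mu}:\mathcal{H}_{\mu,0}^*\to\mathcal{S}_\mu$ is the orthogonal projection with respect to $\mathbf{g}_\mu$. The mean $\langle\dot\mu,\mathrm{id}\rangle$ is the vector whose $i$-th component is $\dot\mu$ applied to the class in $\mathcal{H}_\mu/\mathbb{R}$ of the coordinate function $x\mapsto x_i$; its existence means that these coordinate functions belong to $\mathcal{H}_\mu/\mathbb{R}$. *)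

theory Defs
  imports "HOL-Probability.Probability_Measure"
begin

text \<open>On a compact subset of a Euclidean space every Borel probability measure is Radon.\<close>

definition prob_measures_on :: "'x::topological_space set \<Rightarrow> 'x measure set" where
  "prob_measures_on X = {\<mu>. prob_space \<mu> \<and> sets \<mu> = sets (restrict_space borel X)}"

definition sq_cost :: "'x::real_normed_vector \<Rightarrow> 'x \<Rightarrow> real" where
  "sq_cost x y = (norm (x - y))\<^sup>2"

definition gibbs_kernel ::
  "real \<Rightarrow> ('x::real_normed_vector \<Rightarrow> real) \<Rightarrow> 'x \<Rightarrow> 'x \<Rightarrow> real" where
  "gibbs_kernel \<epsilon> f x y = exp (1 / \<epsilon> * (f x + f y - sq_cost x y))"

text \<open>The property determining \<open>f\<^bsub>\<mu>,\<mu>\<^esub>\<close> as an element of \<open>C(X)\<close>;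
  values of \<open>f\<close> outside \<open>X\<close> are irrelevant.\<close>

definition schroedinger_potential ::
  "real \<Rightarrow> 'x::real_normed_vector set \<Rightarrow> 'x measure \<Rightarrow> ('x \<Rightarrow> real) \<Rightarrow> bool" where
  "schroedinger_potential \<epsilon> X \<mu> f \<longleftrightarrow>
     continuous_on X f \<and> (\<forall>y\<in>X. (LINT x|\<mu>. gibbs_kernel \<epsilon> f x y) = 1)"

text \<open>The reproducing kernel Hilbert space of \<open>k\<close> on \<open>X\<close> is a Hilbert type \<open>'h\<close> together with an
  evaluation map \<open>evl\<close> identifying its elements with functions on \<open>X\<close>.  The function \<open>evl \<phi>\<close>
  is only meaningful on \<open>X\<close>.  By the uniqueness of the RKHS of a kernel, \<open>('h, evl)\<close> is
  determined up to an isometry that respects evaluation.\<close>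

definition is_rkhs ::
  "'x set \<Rightarrow> ('x \<Rightarrow> 'x \<Rightarrow> real) \<Rightarrow> ('h::{real_inner,complete_space} \<Rightarrow> 'x \<Rightarrow> real) \<Rightarrow> bool" where
  "is_rkhs X k evl \<longleftrightarrow>
     (\<forall>x\<in>X. linear (\<lambda>\<phi>. evl \<phi> x)) \<and>
     (\<forall>\<phi> \<psi>. (\<forall>x\<in>X. evl \<phi> x = evl \<psi> x) \<longrightarrow> \<phi> = \<psi>) \<and>
     (\<forall>y\<in>X. \<exists>\<kappa>. (\<forall>x\<in>X. evl \<kappa> x = k x y) \<and> (\<forall>\<phi>. evl \<phi> y = inner \<phi> \<kappa>))"

text \<open>The element of the space whose function on \<open>X\<close> is \<open>u\<close>.\<close>

definition elem_of :: "'x set \<Rightarrow> ('h \<Rightarrow> 'x \<Rightarrow> real) \<Rightarrow> ('x \<Rightarrow> real) \<Rightarrow> 'h" where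
  "elem_of X evl u = (THE \<phi>. \<forall>x\<in>X. evl \<phi> x = u x)"

definition K_op ::
  "'x set \<Rightarrow> 'x measure \<Rightarrow> ('x \<Rightarrow> 'x \<Rightarrow> real) \<Rightarrow> ('h \<Rightarrow> 'x \<Rightarrow> real) \<Rightarrow> 'h \<Rightarrow> 'h" where
  "K_op X \<mu> k evl \<phi> = elem_of X evl (\<lambda>y. LINT x|\<mu>. evl \<phi> x * k x y)"

definition H_op ::
  "'x set \<Rightarrow> ('x \<Rightarrow> 'x \<Rightarrow> real) \<Rightarrow> ('h::real_normed_vector \<Rightarrow> 'x \<Rightarrow> real) \<Rightarrow>
   ('h \<Rightarrow>\<^sub>L real) \<Rightarrow> 'h" where
  "H_op X k evl \<sigma> = elem_of X evl (\<lambda>y. blinfun_apply \<sigma> (elem_of X evl (\<lambda>x. k x y)))"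

definition dual0 ::
  "'x set \<Rightarrow> ('h::real_normed_vector \<Rightarrow> 'x \<Rightarrow> real) \<Rightarrow> ('h \<Rightarrow>\<^sub>L real) set" where
  "dual0 X evl = {\<sigma>. blinfun_apply \<sigma> (elem_of X evl (\<lambda>_. 1)) = 0}"

definition const_rel :: "'x set \<Rightarrow> ('h \<Rightarrow> 'x \<Rightarrow> real) \<Rightarrow> ('h \<times> 'h) set" where
  "const_rel X evl = {(\<phi>, \<psi>). \<exists>a. \<forall>x\<in>X. evl \<phi> x - evl \<psi> x = a}"

definition quot_space :: "'x set \<Rightarrow> ('h \<Rightarrow> 'x \<Rightarrow> real) \<Rightarrow> 'h set set" where
  "quot_space X evl = UNIV // const_rel X evl"

text \<open>The class of a function \<open>u\<close> modulo constants.  It is an element of \<^const>\<open>quot_space\<close>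
  precisely if \<open>u\<close> belongs, up to a constant, to the Hilbert space; otherwise it is empty.\<close>

definition fun_class :: "'x set \<Rightarrow> ('h \<Rightarrow> 'x \<Rightarrow> real) \<Rightarrow> ('x \<Rightarrow> real) \<Rightarrow> 'h set" where
  "fun_class X evl u = {\<phi>. \<exists>a. \<forall>x\<in>X. evl \<phi> x - u x = a}"

text \<open>A functional in \<^const>\<open>dual0\<close> is constant on each class.\<close>

definition quot_pairing :: "('h::real_normed_vector \<Rightarrow>\<^sub>L real) \<Rightarrow> 'h set \<Rightarrow> real" where
  "quot_pairing \<sigma> C = the_elem (blinfun_apply \<sigma> ` C)"

text \<open>The operator \<open>id - K\<^sub>\<mu>\<^sup>2\<close> induced on classes; \<open>K\<^sub>\<mu>\<close> descends since it fixes the constants.\<close>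

definition id_minus_K2 ::
  "'x set \<Rightarrow> 'x measure \<Rightarrow> ('x \<Rightarrow> 'x \<Rightarrow> real) \<Rightarrow> ('h::real_normed_vector \<Rightarrow> 'x \<Rightarrow> real) \<Rightarrow>
   'h set \<Rightarrow> 'h set" where
  "id_minus_K2 X \<mu> k evl C =
     (\<Union>\<phi>\<in>C. const_rel X evl `` {\<phi> - K_op X \<mu> k evl (K_op X \<mu> k evl \<phi>)})"

definition g_metric ::
  "real \<Rightarrow> 'x set \<Rightarrow> 'x measure \<Rightarrow> ('x \<Rightarrow> 'x \<Rightarrow> real) \<Rightarrow>
   ('h::real_normed_vector \<Rightarrow> 'x \<Rightarrow> real) \<Rightarrow> ('h \<Rightarrow>\<^sub>L real) \<Rightarrow> ('h \<Rightarrow>\<^sub>L real) \<Rightarrow> real" where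
  "g_metric \<epsilon> X \<mu> k evl \<sigma>\<^sub>1 \<sigma>\<^sub>2 =
     \<epsilon> / 2 * quot_pairing \<sigma>\<^sub>1
       (inv_into (quot_space X evl) (id_minus_K2 X \<mu> k evl)
          (const_rel X evl `` {H_op X k evl \<sigma>\<^sub>2}))"

text \<open>Gradient of a function in \<open>C\<^sup>1(X)\<close>, where \<open>X\<close> is the closure of an open set: the
  continuous extension to \<open>X\<close> of the gradient in the interior.  It is unique on \<open>X\<close>
  because the interior is dense; at boundary points a derivative within \<open>X\<close> need not be
  unique and could not be used instead.\<close>

definition gradient_on ::
  "'x::real_inner set \<Rightarrow> ('x \<Rightarrow> real) \<Rightarrow> 'x \<Rightarrow> 'x" where
  "gradient_on X u = (SOME G. continuous_on X G \<and> (\<forall>x\<in>interior X. GDERIV u x :> G x))"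

text \<open>The functional \<open>- div (v \<mu>)\<close>.\<close>

definition neg_div ::
  "'x::real_inner set \<Rightarrow> 'x measure \<Rightarrow> ('h::real_normed_vector \<Rightarrow> 'x \<Rightarrow> real) \<Rightarrow>
   'x \<Rightarrow> ('h \<Rightarrow>\<^sub>L real)" where
  "neg_div X \<mu> evl v = Blinfun (\<lambda>\<phi>. LINT x|\<mu>. inner v (gradient_on X (evl \<phi>) x))"

definition S_space ::
  "'x::real_inner set \<Rightarrow> 'x measure \<Rightarrow> ('h::real_normed_vector \<Rightarrow> 'x \<Rightarrow> real) \<Rightarrow>
   ('h \<Rightarrow>\<^sub>L real) set" where
  "S_space X \<mu> evl = range (neg_div X \<mu> evl)"

definition orth_proj :: "('v::ab_group_add \<Rightarrow> 'v \<Rightarrow> real) \<Rightarrow> 'v set \<Rightarrow> 'v \<Rightarrow> 'v" where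
  "orth_proj g S \<sigma> = (THE \<tau>. \<tau> \<in> S \<and> (\<forall>\<rho>\<in>S. g (\<sigma> - \<tau>) \<rho> = 0))"

definition mean_vec ::
  "(real ^ 'n) set \<Rightarrow> ('h::real_normed_vector \<Rightarrow> real ^ 'n \<Rightarrow> real) \<Rightarrow> ('h \<Rightarrow>\<^sub>L real) \<Rightarrow>
   real ^ 'n" where
  "mean_vec X evl \<sigma> = (\<chi> i. quot_pairing \<sigma> (fun_class X evl (\<lambda>x. x $ i)))"

end

theory Submission
  imports Defs
begin

text \<open>
  Put \<open>b = 2 / \<epsilon>\<close>.  Since \<open>\<parallel>x - y\<parallel>\<^sup>2\<close> splits, \<open>k x y = a x * a y * exp (b * (x \<bullet> y))\<close>, so the Hilbert
  space consists, up to the factor \<open>a\<close>, of functions \<open>\<phi> \<bullet> e x\<close> with \<open>e x \<bullet> e y = exp (b * (x \<bullet> y))\<close>.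
  The explicit kernel makes difference quotients of \<open>e\<close> Cauchy, also at boundary points, which yields
  the gradients.  Differentiating \<open>K[1] = 1\<close> gives \<open>\<nabla>\<^sub>x k(x, y) = b k(x, y) (y - K[id](x))\<close>, hence
  \<open>H[- div (v \<mu>)] = b (id - K\<^sup>2)[v \<bullet> id]\<close>.  So \<open>v \<bullet> id\<close> lies in the space and
  \<open>g(\<sigma>, - div (v \<mu>)) = \<langle>\<sigma>, v \<bullet> id\<rangle>\<close>; the projection formula and the orthogonal decomposition follow,
  because \<open>\<langle>- div (w \<mu>), v \<bullet> id\<rangle> = w \<bullet> v\<close>.
\<close>

subsection \<open>Hilbert space preliminaries\<close>

text \<open>Expanding the squared norm of \<open>q m - q n\<close> gives
  \<open>L - 2 * L + L = 0\<close> in the limit, so a double limit of scalars suffices and no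
  candidate for the limit of \<open>q\<close> is needed.\<close>

lemma Cauchy_if_inner_convergent:
  fixes q :: "nat \<Rightarrow> 'h::real_inner"
  assumes "((\<lambda>p. inner (q (fst p)) (q (snd p))) \<longlongrightarrow> L) (sequentially \<times>\<^sub>F sequentially)"
  shows "Cauchy q"
proof (rule CauchyI)
  fix e :: real
  assume "0 < e"
  \<comment> \<open>A quarter, because the three inner products in the expansion enter with weights
    1, 2 and 1.\<close>
  then have "0 < e\<^sup>2 / 4" by simp
  then have "\<forall>\<^sub>F p in sequentially \<times>\<^sub>F sequentially.
      dist (inner (q (fst p)) (q (snd p))) L < e\<^sup>2 / 4"
    using assms by (rule tendstoD[rotated])
  then obtain M where M: "\<And>m n. m \<ge> M \<Longrightarrow> n \<ge> M \<Longrightarrow> \<bar>inner (q m) (q n) - L\<bar> < e\<^sup>2 / 4"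
    by (force simp: eventually_prod_sequentially dist_real_def)
  show "\<exists>M. \<forall>m\<ge>M. \<forall>n\<ge>M. norm (q m - q n) < e"
  proof (intro exI allI impI)
    fix m n assume mn: "m \<ge> M" "n \<ge> M"
    have "(norm (q m - q n))\<^sup>2 = inner (q m) (q m) - 2 * inner (q m) (q n) + inner (q n) (q n)"
      by (simp add: power2_norm_eq_inner inner_diff_left inner_diff_right inner_commute)
    also have "\<dots> < e\<^sup>2"
      using M[OF mn(1) mn(1)] M[OF mn] M[OF mn(2) mn(2)] by linarith
    finally show "norm (q m - q n) < e"
      using \<open>0 < e\<close> by (simp add: power_less_imp_less_base)
  qed
qed

text \<open>The representing vector minimises \<open>\<parallel>x\<parallel>\<^sup>2 - 2 \<sigma> x\<close>; a minimising sequence is Cauchy by the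
  parallelogram law.\<close>

lemma riesz_representation:
  fixes \<sigma> :: "'h::{real_inner,complete_space} \<Rightarrow> real"
  assumes "bounded_linear \<sigma>"
  shows "\<exists>h. \<forall>x. \<sigma> x = inner x h"
proof -
  interpret bounded_linear \<sigma> by fact
  define J where "J x = (norm x)\<^sup>2 - 2 * \<sigma> x" for x
  obtain K where K: "\<And>x. norm (\<sigma> x) \<le> norm x * K" using bounded by blast
  have J_ge: "J x \<ge> - K\<^sup>2" for x
  proof -
    have "0 \<le> (norm x - K)\<^sup>2" by simp
    then show ?thesis using K[of x] by (simp add: J_def power2_diff)
  qed
  define m where "m = Inf (range J)"
  have bdd: "bdd_below (range J)" using J_ge by (auto intro!: bdd_belowI)
  have m_le: "m \<le> J x" for x unfolding m_def by (rule cInf_lower[OF _ bdd]) simp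
  have "\<exists>x. J x < m + 1 / Suc n" for n
  proof -
    have "Inf (range J) < m + 1 / Suc n" by (simp add: m_def)
    then show ?thesis using cInf_lessD[of "range J"] by blast
  qed
  then obtain xs where xs: "\<And>n. J (xs n) < m + 1 / Suc n" by metis
  have par: "(norm (x - y))\<^sup>2 = 2 * J x + 2 * J y - 4 * J ((1/2) *\<^sub>R (x + y))" for x y
    by (simp add: J_def power2_norm_eq_inner inner_diff_left inner_diff_right inner_add_left
        inner_add_right inner_commute add scale algebra_simps)
  have "Cauchy xs"
  proof (rule CauchyI)
    fix e :: real
    assume e: "0 < e"
    obtain M where M: "1 / Suc M < e\<^sup>2 / 4"
      using e nat_approx_posE[of "e\<^sup>2 / 4"] by auto
    show "\<exists>M. \<forall>m\<ge>M. \<forall>n\<ge>M. norm (xs m - xs n) < e"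
    proof (intro exI allI impI)
      fix i j assume ij: "i \<ge> M" "j \<ge> M"
      have le: "1 / real (Suc i) \<le> 1 / Suc M" "1 / real (Suc j) \<le> 1 / Suc M"
        using ij by (auto simp: divide_simps)
      \<comment> \<open>The midpoint has \<open>J\<close> at least \<open>m\<close>, so
        \<open>par\<close> leaves less than \<open>2 / Suc i + 2 / Suc j\<close>, which is at most
        \<open>4 / Suc M\<close>.\<close>
      have "(norm (xs i - xs j))\<^sup>2 < e\<^sup>2"
        using par[of "xs i" "xs j"] xs[of i] xs[of j] m_le[of "(1/2) *\<^sub>R (xs i + xs j)"] M le
        by linarith
      then show "norm (xs i - xs j) < e"
        using e by (simp add: power_less_imp_less_base)
    qed
  qed
  then obtain h where h: "xs \<longlonglongrightarrow> h" using Cauchy_convergent convergent_def by blast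
  have "(\<lambda>n. J (xs n)) \<longlonglongrightarrow> J h" unfolding J_def by (intro tendsto_intros h tendsto)
  moreover have "(\<lambda>n. m + 1 / Suc n) \<longlonglongrightarrow> m"
    using tendsto_add[OF tendsto_const LIMSEQ_inverse_real_of_nat, of m]
    by (simp add: inverse_eq_divide)
  ultimately have "J h \<le> m"
    using xs by (intro LIMSEQ_le[where X = "\<lambda>n. J (xs n)"]) (auto intro: less_imp_le)
  then have J_min: "J h \<le> J x" for x using m_le[of x] by simp
  have "\<sigma> x = inner x h" for x
  proof (cases "x = 0")
    case False
    \<comment> \<open>This step minimises \<open>J\<close> along the line through \<open>h\<close>
      in direction \<open>x\<close>; it would lower \<open>J\<close> by the squared defect divided
      by the squared norm of \<open>x\<close>.\<close>
    define c where "c = (\<sigma> x - inner x h) / (norm x)\<^sup>2"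
    have "J (h + c *\<^sub>R x) = J h + c * (c * (norm x)\<^sup>2) - 2 * c * (\<sigma> x - inner x h)"
      by (simp add: J_def power2_norm_eq_inner inner_add_left inner_add_right inner_commute
          add scale algebra_simps)
    also have "c * (norm x)\<^sup>2 = \<sigma> x - inner x h" using False by (simp add: c_def)
    finally have "c * (\<sigma> x - inner x h) \<le> 0"
      using J_min[of "h + c *\<^sub>R x"] by (simp add: algebra_simps)
    then have "(\<sigma> x - inner x h)\<^sup>2 / (norm x)\<^sup>2 \<le> 0"
      by (simp add: c_def power2_eq_square)
    then have "(\<sigma> x - inner x h)\<^sup>2 \<le> 0"
      using False by (simp add: divide_le_0_iff)
    then show ?thesis by simp
  qed (simp add: zero)
  then show ?thesis by blast
qed

text \<open>The squared distance is \<open>M y y - 2 * M x y + M x x\<close>, so norm continuity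
  reduces to scalar continuity of the Gram kernel in one argument and on the diagonal.\<close>

lemma continuous_on_if_inner_eq:
  fixes g :: "'a::metric_space \<Rightarrow> 'h::real_inner"
  assumes "\<And>x y. x \<in> X \<Longrightarrow> y \<in> X \<Longrightarrow> inner (g x) (g y) = M x y"
    and M: "\<And>x. x \<in> X \<Longrightarrow> continuous_on X (M x)" "continuous_on X (\<lambda>x. M x x)"
  shows "continuous_on X g"
  unfolding continuous_on
proof
  fix x assume x: "x \<in> X"
  have "((\<lambda>y. M y y - 2 * M x y + M x x) \<longlongrightarrow> M x x - 2 * M x x + M x x) (at x within X)"
    using M(1)[OF x] M(2) x unfolding continuous_on by (intro tendsto_intros) auto
  moreover have "(norm (g y - g x))\<^sup>2 = M y y - 2 * M x y + M x x" if "y \<in> X" for y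
    using that x assms(1)[of x x] assms(1)[of x y] assms(1)[of y y]
    by (simp add: power2_norm_eq_inner inner_diff_left inner_diff_right inner_commute)
  ultimately have "((\<lambda>y. (norm (g y - g x))\<^sup>2) \<longlongrightarrow> 0) (at x within X)"
    by (subst Lim_cong_within[OF refl refl refl, where g = "\<lambda>y. M y y - 2 * M x y + M x x"]) auto
  then have "((\<lambda>y. sqrt ((norm (g y - g x))\<^sup>2)) \<longlongrightarrow> sqrt 0) (at x within X)"
    by (rule tendsto_real_sqrt)
  then show "(g \<longlongrightarrow> g x) (at x within X)"
    by (simp add: LIM_zero_iff tendsto_norm_zero_iff)
qed

subsection \<open>Feature maps of the exponential kernel\<close>

text \<open>Difference quotient of \<open>exp\<close> at 0 with the removable singularity filled in,
  so that directions orthogonal to a point need no separate case.\<close>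

definition exp_slope :: "real \<Rightarrow> real" where
  "exp_slope z = (if z = 0 then 1 else (exp z - 1) / z)"

lemma exp_minus_1_eq_slope: "exp z - 1 = z * exp_slope z"
  by (simp add: exp_slope_def)

lemma exp_slope_quotient: "t \<noteq> 0 \<Longrightarrow> (exp (t * c) - 1) / t = c * exp_slope (t * c)"
  by (simp add: exp_minus_1_eq_slope)

lemma exp_slope_0 [simp]: "exp_slope 0 = 1"
  by (simp add: exp_slope_def)

lemma tendsto_exp_slope_0:
  assumes "(f \<longlongrightarrow> 0) F"
  shows "((\<lambda>x. exp_slope (f x)) \<longlongrightarrow> 1) F"
proof -
  have "((\<lambda>z::real. (exp z - 1) / z) \<longlongrightarrow> 1) (at 0)" by (rule lim_exp_minus_1)
  then have "(exp_slope \<longlongrightarrow> 1) (at 0)"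
    by (subst Lim_cong_within[OF refl refl refl, where g = "\<lambda>z. (exp z - 1) / z"])
      (auto simp: exp_slope_def)
  then have "isCont exp_slope 0" by (simp add: isCont_def)
  then show ?thesis using isCont_tendsto_compose[OF _ assms, of exp_slope] by simp
qed

locale exp_features =
  fixes X :: "'a::euclidean_space set" and b :: real
    and e :: "'a \<Rightarrow> 'h::{real_inner,complete_space}"
  assumes b_pos: "b > 0"
    and closure_interior: "X \<subseteq> closure (interior X)"
    and inner_e: "\<And>x y. x \<in> X \<Longrightarrow> y \<in> X \<Longrightarrow> inner (e x) (e y) = exp (b * inner x y)"
    and total: "\<And>\<phi>. (\<And>y. y \<in> X \<Longrightarrow> inner \<phi> (e y) = 0) \<Longrightarrow> \<phi> = 0"
begin

section \<open>Difference quotients of the feature map and their limits\<close>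

definition quot :: "'a \<Rightarrow> real \<Rightarrow> 'a \<Rightarrow> 'h" where
  "quot x t v = (1 / t) *\<^sub>R (e (x + t *\<^sub>R v) - e x)"

definition adm :: "'a \<Rightarrow> 'a \<Rightarrow> (nat \<Rightarrow> 'a) \<Rightarrow> (nat \<Rightarrow> real) \<Rightarrow> bool" where
  "adm v x xs ts \<longleftrightarrow> (\<forall>n. xs n \<in> X \<and> xs n + ts n *\<^sub>R v \<in> X \<and> ts n \<noteq> 0) \<and> xs \<longlonglongrightarrow> x \<and> ts \<longlonglongrightarrow> 0"

text \<open>At a boundary point \<open>x\<close> the points \<open>x + t v\<close> may all lie outside \<open>X\<close>; the base point is
  therefore moved into the interior.\<close>

lemma ex_adm:
  assumes "x \<in> X"
  shows "\<exists>xs ts. adm v x xs ts"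
proof -
  have "\<exists>z t. z \<in> X \<and> z + t *\<^sub>R v \<in> X \<and> t \<noteq> 0 \<and> dist z x < 1 / Suc n \<and> \<bar>t\<bar> < 1 / Suc n" for n
  proof -
    have "x \<in> closure (interior X)" using assms closure_interior by blast
    then obtain z where z: "z \<in> interior X" "dist z x < 1 / Suc n"
      unfolding closure_approachable by (meson of_nat_0_less_iff zero_less_Suc zero_less_divide_1_iff)
    then obtain r where r: "r > 0" "ball z r \<subseteq> X" by (auto simp: mem_interior)
    \<comment> \<open>The first bound keeps the shifted point in the ball, with
      \<open>norm v + 1\<close> guarding against \<open>v = 0\<close>; the second makes
      \<open>t\<close> smaller than \<open>1 / Suc n\<close>.\<close>
    define t where "t = min (r / (2 * (norm v + 1))) (1 / (2 * Suc n))"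
    have n1: "norm v + 1 > 0" using norm_ge_zero[of v] by linarith
    have t: "t > 0" "t < 1 / Suc n" "t \<le> r / (2 * (norm v + 1))"
    proof -
      show "t > 0" using r n1 unfolding t_def by simp
      have "t \<le> 1 / (2 * real (Suc n))" by (simp add: t_def)
      also have "\<dots> < 1 / real (Suc n)" by (simp add: divide_strict_left_mono)
      finally show "t < 1 / Suc n" .
    qed (simp add: t_def)
    have "t * norm v \<le> t * (norm v + 1)" using t by (simp add: mult_left_mono)
    also have "\<dots> \<le> r / (2 * (norm v + 1)) * (norm v + 1)"
      by (rule mult_right_mono[OF t(3)]) (use n1 in linarith)
    also have "\<dots> = r / 2" proof -
      have "r / (2 * c) * c = r / 2" if "c > 0" for c using that by simp
      then show ?thesis using n1 .
    qed
    also have "\<dots> < r" using r by simp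
    finally have "z + t *\<^sub>R v \<in> ball z r" using t by (simp add: dist_norm)
    then show ?thesis using z r t interior_subset
      by (intro exI[of _ z] exI[of _ t]) auto
  qed
  then have "\<forall>n. \<exists>z t. z \<in> X \<and> z + t *\<^sub>R v \<in> X \<and> t \<noteq> 0
      \<and> dist z x < 1 / Suc n \<and> \<bar>t\<bar> < 1 / Suc n" ..
  from choice[OF this] obtain xs where "\<forall>n. \<exists>t. xs n \<in> X \<and> xs n + t *\<^sub>R v \<in> X \<and> t \<noteq> 0
      \<and> dist (xs n) x < 1 / Suc n \<and> \<bar>t\<bar> < 1 / Suc n" ..
  from choice[OF this] obtain ts where "\<forall>n. xs n \<in> X \<and> xs n + ts n *\<^sub>R v \<in> X \<and> ts n \<noteq> 0
      \<and> dist (xs n) x < 1 / Suc n \<and> \<bar>ts n\<bar> < 1 / Suc n" ..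
  then have *: "xs n \<in> X" "xs n + ts n *\<^sub>R v \<in> X" "ts n \<noteq> 0"
      "dist (xs n) x < 1 / Suc n" "\<bar>ts n\<bar> < 1 / Suc n" for n
    by simp_all
  have lim: "(\<lambda>n. 1 / real (Suc n)) \<longlonglongrightarrow> 0"
    using LIMSEQ_inverse_real_of_nat by (simp add: inverse_eq_divide)
  have "(\<lambda>n. dist (xs n) x) \<longlonglongrightarrow> 0"
    using * by (intro real_tendsto_sandwich[OF _ _ tendsto_const lim]) (auto intro!: always_eventually less_imp_le)
  then have "xs \<longlonglongrightarrow> x" by (rule tendsto_dist_iff[THEN iffD2])
  moreover have "ts \<longlonglongrightarrow> 0"
    by (rule Lim_null_comparison[OF _ lim]) (use * in \<open>auto intro!: always_eventually less_imp_le\<close>)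
  ultimately show ?thesis using * unfolding adm_def by blast
qed

lemma inner_quot_e:
  assumes "x \<in> X" "x + t *\<^sub>R v \<in> X" "t \<noteq> 0" "y \<in> X"
  shows "inner (quot x t v) (e y)
    = exp (b * inner x y) * (b * inner v y * exp_slope (t * (b * inner v y)))"
proof -
  have "inner (quot x t v) (e y)
      = exp (b * inner x y) * ((exp (t * (b * inner v y)) - 1) / t)"
    using assms by (simp add: quot_def inner_diff_left inner_e inner_add_left distrib_left exp_add
        algebra_simps diff_divide_distrib)
  then show ?thesis using assms by (simp add: exp_slope_quotient)
qed

text \<open>Every division by a step is absorbed into \<open>exp_slope\<close>, so the right-hand
  side has a limit as both steps tend to 0.\<close>

lemma inner_quot_quot:
  assumes "x \<in> X" "x + t *\<^sub>R v \<in> X" "t \<noteq> 0" "y \<in> X" "y + s *\<^sub>R w \<in> X" "s \<noteq> 0"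
  shows "inner (quot x t v) (quot y s w) = exp (b * inner x y) *
    ((b * inner v y * exp_slope (t * (b * inner v y))) * (b * inner w x * exp_slope (s * (b * inner w x)))
     + exp (t * (b * inner v y)) * exp (s * (b * inner w x)) * (b * inner v w * exp_slope (t * s * (b * inner v w))))"
proof -
  let ?A = "exp (t * (b * inner v y))" and ?B = "exp (s * (b * inner w x))"
    and ?C = "exp (t * s * (b * inner v w))" and ?E = "exp (b * inner x y)"
  have 1: "exp (b * inner (x + t *\<^sub>R v) y) = ?E * ?A" "exp (b * inner x (y + s *\<^sub>R w)) = ?E * ?B"
    "exp (b * inner (x + t *\<^sub>R v) (y + s *\<^sub>R w)) = ?E * ?A * ?B * ?C"
    by (simp_all add: inner_add_left inner_add_right inner_commute exp_add[symmetric] algebra_simps)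
  have "inner (quot x t v) (quot y s w) = (?E * ?A * ?B * ?C - ?E * ?A - ?E * ?B + ?E) / (t * s)"
  proof -
    have "inner (quot x t v) (quot y s w)
        = ((exp (b * inner (x + t *\<^sub>R v) (y + s *\<^sub>R w)) - exp (b * inner x (y + s *\<^sub>R w))) / t
          - (exp (b * inner (x + t *\<^sub>R v) y) - exp (b * inner x y)) / t) / s"
      using assms by (simp add: quot_def inner_diff_left inner_diff_right inner_e)
    also have "\<dots> = (?E * ?A * ?B * ?C - ?E * ?A - ?E * ?B + ?E) / (t * s)"
      unfolding 1 using assms by (simp add: field_simps)
    finally show ?thesis .
  qed
  \<comment> \<open>Uses \<open>?A * ?B * ?C - ?A - ?B + 1 = (?A - 1) * (?B - 1) + ?A * ?B * (?C -
    1)\<close>, which matches each factor with its own step.\<close>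
  also have "\<dots> = ?E * (((?A - 1) / t) * ((?B - 1) / s) + ?A * ?B * ((?C - 1) / (t * s)))"
    using assms by (simp add: field_simps)
  finally show ?thesis using assms by (simp add: exp_slope_quotient)
qed

text \<open>The limit is the mixed second derivative of \<open>exp (b * inner x y)\<close>. The
  filter is arbitrary because the Cauchy property needs the product filter and
  \<open>inner_D_D\<close> a single sequence.\<close>

lemma inner_quot_quot_tendsto:
  assumes "(xs \<longlongrightarrow> x) F" "(ts \<longlongrightarrow> 0) F" "(ys \<longlongrightarrow> y) F" "(ss \<longlongrightarrow> 0) F"
    and "\<And>i. xs i \<in> X \<and> xs i + ts i *\<^sub>R v \<in> X \<and> ts i \<noteq> 0"
    and "\<And>i. ys i \<in> X \<and> ys i + ss i *\<^sub>R w \<in> X \<and> ss i \<noteq> 0"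
  shows "((\<lambda>i. inner (quot (xs i) (ts i) v) (quot (ys i) (ss i) w))
    \<longlongrightarrow> (b * inner v w + b * inner v y * (b * inner w x)) * exp (b * inner x y)) F"
proof -
  have z: "((\<lambda>i. ts i * (b * inner v (ys i))) \<longlongrightarrow> 0) F" "((\<lambda>i. ss i * (b * inner w (xs i))) \<longlongrightarrow> 0) F"
    "((\<lambda>i. ts i * ss i * (b * inner v w)) \<longlongrightarrow> 0) F"
    by (auto intro!: tendsto_eq_intros assms)
  have "((\<lambda>i. exp (b * inner (xs i) (ys i)) *
    ((b * inner v (ys i) * exp_slope (ts i * (b * inner v (ys i))))
      * (b * inner w (xs i) * exp_slope (ss i * (b * inner w (xs i))))
     + exp (ts i * (b * inner v (ys i))) * exp (ss i * (b * inner w (xs i)))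
      * (b * inner v w * exp_slope (ts i * ss i * (b * inner v w)))))
    \<longlongrightarrow> exp (b * inner x y) * (b * inner v y * 1 * (b * inner w x * 1)
      + exp 0 * exp 0 * (b * inner v w * 1))) F"
    by (intro tendsto_intros assms tendsto_exp_slope_0 z)
  then show ?thesis using assms(5,6) by (simp add: inner_quot_quot algebra_simps)
qed

text \<open>Directional derivative of \<open>e\<close>, also at boundary points of \<open>X\<close>.
  The choice is harmless: \<open>inner_D_e\<close> fixes the pairings with all \<open>e y\<close>,
  and these determine the vector by \<open>total\<close>.\<close>

definition D :: "'a \<Rightarrow> 'a \<Rightarrow> 'h" where
  "D v x = (SOME d. \<exists>xs ts. adm v x xs ts \<and> (\<lambda>n. quot (xs n) (ts n) v) \<longlonglongrightarrow> d)"

lemma D_limit: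
  assumes "x \<in> X"
  shows "\<exists>xs ts. adm v x xs ts \<and> (\<lambda>n. quot (xs n) (ts n) v) \<longlonglongrightarrow> D v x"
proof -
  obtain xs ts where a: "adm v x xs ts" using ex_adm[OF assms] by blast
  let ?q = "\<lambda>n. quot (xs n) (ts n) v"
  let ?F = "sequentially \<times>\<^sub>F sequentially"
  have "((\<lambda>p. inner (?q (fst p)) (?q (snd p)))
      \<longlongrightarrow> (b * inner v v + b * inner v x * (b * inner v x)) * exp (b * inner x x)) ?F"
    using a unfolding adm_def
    by (intro inner_quot_quot_tendsto filterlim_compose[OF _ filterlim_fst]
        filterlim_compose[OF _ filterlim_snd]) auto
  then have "Cauchy ?q"
    by (rule Cauchy_if_inner_convergent)
  then obtain d where "?q \<longlonglongrightarrow> d" using Cauchy_convergent convergent_def by blast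
  with a have "\<exists>d xs ts. adm v x xs ts \<and> (\<lambda>n. quot (xs n) (ts n) v) \<longlonglongrightarrow> d" by blast
  then show ?thesis unfolding D_def by (rule someI_ex)
qed

lemma inner_D_e:
  assumes "x \<in> X" "y \<in> X"
  shows "inner (D v x) (e y) = b * inner v y * exp (b * inner x y)"
proof -
  obtain xs ts where a: "adm v x xs ts" and l: "(\<lambda>n. quot (xs n) (ts n) v) \<longlonglongrightarrow> D v x"
    using D_limit[OF assms(1)] by blast
  have "(\<lambda>n. exp (b * inner (xs n) y) * (b * inner v y * exp_slope (ts n * (b * inner v y))))
      \<longlonglongrightarrow> exp (b * inner x y) * (b * inner v y * 1)"
    using a unfolding adm_def
    by (intro tendsto_intros tendsto_exp_slope_0 tendsto_mult_left_zero) auto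
  then have "(\<lambda>n. inner (quot (xs n) (ts n) v) (e y)) \<longlonglongrightarrow> b * inner v y * exp (b * inner x y)"
    using a assms(2) unfolding adm_def by (simp add: inner_quot_e mult.commute)
  moreover have "(\<lambda>n. inner (quot (xs n) (ts n) v) (e y)) \<longlonglongrightarrow> inner (D v x) (e y)"
    by (intro tendsto_intros l)
  ultimately show ?thesis using LIMSEQ_unique by blast
qed

lemma inner_D_D:
  assumes "x \<in> X" "y \<in> X"
  shows "inner (D v x) (D w y)
    = (b * inner v w + b * inner v y * (b * inner w x)) * exp (b * inner x y)"
proof -
  obtain xs ts where a: "adm v x xs ts" and l: "(\<lambda>n. quot (xs n) (ts n) v) \<longlonglongrightarrow> D v x"
    using D_limit[OF assms(1)] by blast
  obtain ys ss where a': "adm w y ys ss" and l': "(\<lambda>n. quot (ys n) (ss n) w) \<longlonglongrightarrow> D w y"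
    using D_limit[OF assms(2)] by blast
  have "(\<lambda>n. inner (quot (xs n) (ts n) v) (quot (ys n) (ss n) w)) \<longlonglongrightarrow> inner (D v x) (D w y)"
    by (intro tendsto_intros l l')
  moreover have "(\<lambda>n. inner (quot (xs n) (ts n) v) (quot (ys n) (ss n) w))
      \<longlonglongrightarrow> (b * inner v w + b * inner v y * (b * inner w x)) * exp (b * inner x y)"
    using a a' unfolding adm_def by (intro inner_quot_quot_tendsto) auto
  ultimately show ?thesis using LIMSEQ_unique by blast
qed

lemma continuous_on_D: "continuous_on X (D v)"
  by (rule continuous_on_if_inner_eq[where M = "\<lambda>x y.
    (b * inner v v + b * inner v y * (b * inner v x)) * exp (b * inner x y)"])
    (auto simp: inner_D_D intro!: continuous_intros)

lemma continuous_on_e: "continuous_on X e"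
  by (rule continuous_on_if_inner_eq[where M = "\<lambda>x y. exp (b * inner x y)"])
    (auto simp: inner_e intro!: continuous_intros)

lemma linear_D:
  assumes "x \<in> X"
  shows "linear (\<lambda>v. D v x)"
proof (rule linearI)
  have "D (v + w) x - (D v x + D w x) = 0" for v w
    using assms by (intro total) (simp add: inner_D_e inner_diff_left inner_add_left algebra_simps)
  then show "D (v + w) x = D v x + D w x" for v w by simp
  have "D (r *\<^sub>R v) x - r *\<^sub>R D v x = 0" for r v
    using assms by (intro total) (simp add: inner_D_e inner_diff_left algebra_simps)
  then show "D (r *\<^sub>R v) x = r *\<^sub>R D v x" for r v by simp
qed

text \<open>An exact formula, grouped for the estimate: \<open>s\<close> is of order
  \<open>norm h\<close>, \<open>n\<close> is of order \<open>norm h\<close> squared, and each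
  summand is of second order times a factor tending to 0.\<close>

lemma norm_remainder_e:
  assumes "x \<in> X" "x + h \<in> X"
  defines "s \<equiv> b * inner h x" and "n \<equiv> b * inner h h"
  shows "(norm (e (x + h) - e x - D h x))\<^sup>2 = exp (b * inner x x) *
    ((s * (exp_slope s - 1))\<^sup>2 + exp s * exp s * (n * (exp_slope n - 1)) + n * (exp s - 1)\<^sup>2)"
proof -
  let ?E = "exp (b * inner x x)"
  have E: "exp (b * inner (x + h) (x + h)) = ?E * exp s * exp s * exp n"
    "exp (b * inner (x + h) x) = ?E * exp s" "exp (b * inner x (x + h)) = ?E * exp s"
    by (simp_all add: s_def n_def inner_add_left inner_add_right inner_commute
        exp_add[symmetric] algebra_simps)
  have "(norm (e (x + h) - e x - D h x))\<^sup>2 = inner (e (x + h)) (e (x + h)) + inner (e x) (e x)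
      + inner (D h x) (D h x) - 2 * inner (e (x + h)) (e x) - 2 * inner (D h x) (e (x + h))
      + 2 * inner (D h x) (e x)"
    by (simp add: power2_norm_eq_inner inner_diff_left inner_diff_right inner_commute)
  also have "\<dots> = ?E * exp s * exp s * exp n + ?E + (n + s * s) * ?E - 2 * (?E * exp s)
      - 2 * (s + n) * (?E * exp s) + 2 * s * ?E"
    using assms(1,2)
    by (simp add: inner_e inner_D_e inner_D_D E) (simp add: s_def n_def inner_add_right algebra_simps)
  also have "\<dots> = ?E * ((exp s - 1 - s)\<^sup>2 + exp s * exp s * (exp n - 1 - n) + n * (exp s - 1)\<^sup>2)"
    by (simp add: power2_eq_square algebra_simps)
  also have "exp s - 1 - s = s * (exp_slope s - 1)"
    by (simp add: exp_minus_1_eq_slope right_diff_distrib)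
  also have "exp n - 1 - n = n * (exp_slope n - 1)"
    by (simp add: exp_minus_1_eq_slope right_diff_distrib)
  finally show ?thesis .
qed

lemma has_derivative_e:
  assumes x: "x \<in> interior X"
  shows "(e has_derivative (\<lambda>h. D h x)) (at x)"
proof -
  have xX: "x \<in> X" using x interior_subset by blast
  define s where "s h = b * inner h x" for h
  define n where "n h = b * inner h h" for h :: 'a
  define E where "E = exp (b * inner x x)"
  \<comment> \<open>For \<open>x + h\<close> in \<open>X\<close>, \<open>R h\<close> bounds the
    squared remainder divided by the squared norm of \<open>h\<close>.\<close>
  define R where "R h = E * ((b * norm x)\<^sup>2 * (exp_slope (s h) - 1)\<^sup>2
      + b * (exp (s h) * exp (s h)) * \<bar>exp_slope (n h) - 1\<bar> + b * (exp (s h) - 1)\<^sup>2)" for h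
  have s0: "(s \<longlongrightarrow> 0) (at 0)"
    unfolding s_def by (rule tendsto_eq_intros refl)+ simp
  have n0: "(n \<longlongrightarrow> 0) (at 0)"
    unfolding n_def by (rule tendsto_eq_intros refl)+ simp
  have "(R \<longlongrightarrow> E * ((b * norm x)\<^sup>2 * (1 - 1)\<^sup>2 + b * (exp 0 * exp 0) * \<bar>1 - 1\<bar> + b * (exp 0 - 1)\<^sup>2)) (at 0)"
    unfolding R_def by (intro tendsto_intros tendsto_exp_slope_0 s0 n0)
  then have "((\<lambda>h. sqrt (R h)) \<longlongrightarrow> sqrt 0) (at 0)"
    by (intro tendsto_real_sqrt) simp
  then have R0: "((\<lambda>h. sqrt (R h)) \<longlongrightarrow> 0) (at 0)" by simp
  have le: "norm (e (x + h) - e x - D h x) / norm h \<le> sqrt (R h)" if h: "x + h \<in> X" "h \<noteq> 0" for h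
  proof (rule real_le_rsqrt)
    have hh: "inner h h = (norm h)\<^sup>2" by (simp add: power2_norm_eq_inner)
    have "\<bar>s h\<bar> \<le> b * norm x * norm h"
      using Cauchy_Schwarz_ineq2[of h x] b_pos by (simp add: s_def abs_mult mult.commute mult_left_mono)
    then have "(s h)\<^sup>2 \<le> (b * norm x)\<^sup>2 * (norm h)\<^sup>2"
      using power_mono[of "\<bar>s h\<bar>" "b * norm x * norm h" 2]
      by (simp only: power2_abs power_mult_distrib abs_ge_zero)
    then have 1: "(s h * (exp_slope (s h) - 1))\<^sup>2
        \<le> (b * norm x)\<^sup>2 * (exp_slope (s h) - 1)\<^sup>2 * (norm h)\<^sup>2"
      using mult_right_mono[of "(s h)\<^sup>2" "(b * norm x)\<^sup>2 * (norm h)\<^sup>2" "(exp_slope (s h) - 1)\<^sup>2"] by (simp add: power_mult_distrib mult_ac)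
    have 2: "exp (s h) * exp (s h) * (n h * (exp_slope (n h) - 1))
        \<le> b * (exp (s h) * exp (s h)) * \<bar>exp_slope (n h) - 1\<bar> * (norm h)\<^sup>2"
    proof -
      have "exp (s h) * exp (s h) * (n h * (exp_slope (n h) - 1))
          = b * (exp (s h) * exp (s h)) * (norm h)\<^sup>2 * (exp_slope (n h) - 1)"
        by (simp add: n_def hh mult_ac)
      also have "\<dots> \<le> b * (exp (s h) * exp (s h)) * (norm h)\<^sup>2 * \<bar>exp_slope (n h) - 1\<bar>"
        using b_pos by (intro mult_left_mono) auto
      finally show ?thesis by (simp only: mult_ac)
    qed
    have 3: "n h * (exp (s h) - 1)\<^sup>2 = b * (exp (s h) - 1)\<^sup>2 * (norm h)\<^sup>2"
      by (simp add: n_def hh)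
    have "(norm (e (x + h) - e x - D h x))\<^sup>2 = E * ((s h * (exp_slope (s h) - 1))\<^sup>2
        + exp (s h) * exp (s h) * (n h * (exp_slope (n h) - 1)) + n h * (exp (s h) - 1)\<^sup>2)"
      unfolding norm_remainder_e[OF xX h(1)] E_def s_def n_def ..
    also have "\<dots> \<le> R h * (norm h)\<^sup>2"
      using 1 2 3 unfolding R_def mult.assoc[of E] distrib_right
      by (intro mult_left_mono add_mono) (auto simp: E_def)
    finally have "(norm (e (x + h) - e x - D h x))\<^sup>2 \<le> R h * (norm h)\<^sup>2" .
    then show "(norm (e (x + h) - e x - D h x) / norm h)\<^sup>2 \<le> R h"
      using h by (simp add: power_divide divide_simps)
  qed
  have "\<forall>\<^sub>F h in at 0. x + h \<in> X \<and> h \<noteq> 0"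
  proof -
    obtain r where r: "r > 0" "ball x r \<subseteq> X" using x by (auto simp: mem_interior)
    show ?thesis unfolding eventually_at using r
      by (intro exI[of _ r]) (auto simp: dist_norm intro!: subsetD[OF r(2)])
  qed
  then have "(\<lambda>h. norm (e (x + h) - e x - D h x) / norm h) \<midarrow>0\<rightarrow> 0"
    by (intro real_tendsto_sandwich[OF _ _ tendsto_const R0]) (auto elim!: eventually_mono intro: le)
  then show ?thesis
    unfolding has_derivative_at using linear_D[OF xX] by (simp add: linear_conv_bounded_linear)
qed

end

text \<open>Telescoping bounds the tails of \<open>s\<close> by those of \<open>t\<close>. With
  \<open>t\<close> the partial sums of a geometric series this serves the Neumann series in
  \<open>A_surj\<close>.\<close>

lemma Cauchy_if_step_dominated:
  fixes s :: "nat \<Rightarrow> 'h::real_normed_vector" and t :: "nat \<Rightarrow> real"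
  assumes step: "\<And>n. norm (s (Suc n) - s n) \<le> t (Suc n) - t n" and "convergent t"
  shows "Cauchy s"
proof -
  have le: "norm (s m - s n) \<le> t m - t n" if "n \<le> m" for m n
    using that
  proof (induction rule: dec_induct)
    case (step i)
    have "s (Suc i) - s n = (s (Suc i) - s i) + (s i - s n)" by simp
    then have "norm (s (Suc i) - s n) \<le> norm (s (Suc i) - s i) + norm (s i - s n)"
      by (metis norm_triangle_ineq)
    then show ?case using step.IH assms(1)[of i] by linarith
  qed simp
  have "norm (s m - s n) \<le> \<bar>t m - t n\<bar>" for m n
    using le[of m n] le[of n m] by (cases "n \<le> m") (auto simp: norm_minus_commute)
  moreover have "Cauchy t" using assms(2) by (simp add: convergent_Cauchy)
  ultimately show ?thesis
    unfolding Cauchy_iff real_norm_def by (meson le_less_trans)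
qed

text \<open>Derivatives are unique in the interior, and continuous functions that agree there agree
  on its closure \<open>X\<close>; hence any continuous gradient computes the choice in
  \<open>gradient_on\<close>, boundary included.\<close>

lemma gradient_on_eq:
  assumes X: "closure (interior X) = X"
    and G: "continuous_on X G" "\<And>x. x \<in> interior X \<Longrightarrow> GDERIV u x :> G x"
    and x: "x \<in> X"
  shows "gradient_on X u x = G x"
proof -
  define F where "F = gradient_on X u"
  have F: "continuous_on X F" "\<And>x. x \<in> interior X \<Longrightarrow> GDERIV u x :> F x"
    using someI_ex[of "\<lambda>G. continuous_on X G \<and> (\<forall>x\<in>interior X. GDERIV u x :> G x)"] G
    unfolding F_def gradient_on_def by blast+
  have "F y - G y = 0" if "y \<in> interior X" for y
  proof -
    have eq: "(\<lambda>h. inner h (F y)) = (\<lambda>h. inner h (G y))"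
      using F(2)[OF that] G(2)[OF that] unfolding gderiv_def by (rule has_derivative_unique)
    have "inner (F y - G y) (F y - G y) = inner (F y - G y) (F y) - inner (F y - G y) (G y)"
      by (rule inner_diff_right)
    also have "\<dots> = 0" using fun_cong[OF eq] by (simp only: diff_self)
    finally show ?thesis by (simp only: inner_eq_zero_iff)
  qed
  then have "F x - G x = 0"
    using continuous_constant_on_closure[of "interior X" "\<lambda>x. F x - G x" 0 x]
      continuous_on_diff[OF F(1) G(1)] x unfolding X by blast
  then show ?thesis by (simp add: F_def)
qed

subsection \<open>The space of the Gibbs kernel\<close>

locale schroedinger_rkhs =
  fixes U X :: "(real ^ 'n) set"
    and \<epsilon> :: real
    and \<mu> :: "(real ^ 'n) measure"
    and f :: "real ^ 'n \<Rightarrow> real"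
    and k :: "real ^ 'n \<Rightarrow> real ^ 'n \<Rightarrow> real"
    and evl :: "'h::{real_inner,complete_space} \<Rightarrow> real ^ 'n \<Rightarrow> real"
  assumes open_U: "open U" and bounded_U: "bounded U" and X_eq: "X = closure U"
    and eps_pos: "\<epsilon> > 0"
    and \<mu>_prob: "\<mu> \<in> prob_measures_on X"
    and potential: "schroedinger_potential \<epsilon> X \<mu> f"
    and k_eq: "k = gibbs_kernel \<epsilon> f"
    and rkhs: "is_rkhs X k evl"
begin

sublocale prob_space \<mu>
  using \<mu>_prob by (simp add: prob_measures_on_def)

lemma sets_\<mu>: "sets \<mu> = sets (restrict_space borel X)"
  using \<mu>_prob by (simp add: prob_measures_on_def)

lemma space_\<mu>: "space \<mu> = X"
  using sets_eq_imp_space_eq[OF sets_\<mu>] by (simp add: space_restrict_space)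

lemma X_nonempty: "X \<noteq> {}"
  using not_empty space_\<mu> by simp

lemma compact_X: "compact X"
  using bounded_U by (simp add: X_eq compact_closure)

lemma closure_interior_X: "closure (interior X) = X"
proof
  show "closure (interior X) \<subseteq> X"
    using closure_mono[OF interior_subset, of X] compact_X compact_imp_closed by fastforce
  have "U \<subseteq> interior X" using open_U by (simp add: X_eq interior_maximal closure_subset)
  then show "X \<subseteq> closure (interior X)" by (simp add: X_eq closure_mono)
qed

lemma bounded_on_X:
  fixes g :: "real ^ 'n \<Rightarrow> 'b::real_normed_vector"
  assumes "continuous_on X g"
  shows "\<exists>B. \<forall>x\<in>X. norm (g x) \<le> B"
  using compact_imp_bounded[OF compact_continuous_image[OF assms compact_X]]
  by (auto simp: bounded_iff)

lemma integrable_if_continuous: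
  fixes g :: "real ^ 'n \<Rightarrow> real"
  assumes "continuous_on X g"
  shows "integrable \<mu> g"
proof -
  obtain B where "\<And>x. x \<in> X \<Longrightarrow> norm (g x) \<le> B" using bounded_on_X[OF assms] by blast
  moreover have "g \<in> borel_measurable \<mu>"
    using borel_measurable_continuous_on_restrict[OF assms] measurable_cong_sets[OF sets_\<mu> refl]
    by blast
  ultimately show ?thesis
    by (intro integrable_const_bound[where B = B]) (auto simp: space_\<mu>)
qed

lemma abs_integral_le:
  fixes g :: "real ^ 'n \<Rightarrow> real"
  assumes "continuous_on X g" "\<And>x. x \<in> X \<Longrightarrow> \<bar>g x\<bar> \<le> B"
  shows "\<bar>LINT x|\<mu>. g x\<bar> \<le> B"
proof -
  have "norm (LINT x|\<mu>. g x) \<le> (LINT x|\<mu>. norm (g x))" by simp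
  also have "\<dots> \<le> (LINT x|\<mu>. B)"
    using assms by (intro integral_mono integrable_if_continuous continuous_intros) (auto simp: space_\<mu>)
  finally show ?thesis by (simp add: prob_space)
qed

section \<open>Factorisation and bounds of the kernel\<close>

definition b :: real where "b = 2 / \<epsilon>"

lemma b_pos: "b > 0"
  using eps_pos by (simp add: b_def)

definition a :: "real ^ 'n \<Rightarrow> real" where "a x = exp ((f x - (norm x)\<^sup>2) / \<epsilon>)"

lemma a_pos: "a x > 0"
  by (simp add: a_def)

lemma continuous_on_a: "continuous_on X a"
  using potential eps_pos unfolding a_def schroedinger_potential_def by (auto intro!: continuous_intros)

lemma k_factor: "k x y = a x * a y * exp (b * inner x y)"
proof -
  have "(norm (x - y))\<^sup>2 = (norm x)\<^sup>2 + (norm y)\<^sup>2 - 2 * inner x y"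
    by (simp add: power2_norm_eq_inner inner_diff_left inner_diff_right inner_commute)
  then have "1 / \<epsilon> * (f x + f y - sq_cost x y)
      = (f x - (norm x)\<^sup>2) / \<epsilon> + (f y - (norm y)\<^sup>2) / \<epsilon> + b * inner x y"
    by (simp add: sq_cost_def b_def diff_divide_distrib add_divide_distrib)
  then show ?thesis by (simp only: k_eq gibbs_kernel_def a_def exp_add)
qed

lemma k_commute: "k x y = k y x"
  by (simp add: k_factor inner_commute mult.commute)

lemma continuous_on_k: "continuous_on X (\<lambda>x. k x y)"
  unfolding k_factor by (intro continuous_intros continuous_on_a)

lemma integral_k: "y \<in> X \<Longrightarrow> (LINT x|\<mu>. k x y) = 1"
  using potential by (simp add: schroedinger_potential_def k_eq)

text \<open>Compactness gives the positive kernel a positive minimum. It is at most 1 because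
  \<open>k\<close> integrates to 1 against a probability measure; thus \<open>1 - \<delta>\<close>
  can serve as a contraction rate.\<close>

lemma k_lower_bound: "\<exists>\<delta>>0. \<delta> \<le> 1 \<and> (\<forall>x\<in>X. \<forall>y\<in>X. \<delta> \<le> k x y)"
proof -
  have "continuous_on (X \<times> X) (\<lambda>p. k (fst p) (snd p))"
    unfolding k_factor
    by (intro continuous_intros continuous_on_compose2[OF continuous_on_a]) auto
  then obtain p where p: "p \<in> X \<times> X" "\<And>q. q \<in> X \<times> X \<Longrightarrow> k (fst p) (snd p) \<le> k (fst q) (snd q)"
    using continuous_attains_inf[OF compact_Times[OF compact_X compact_X], of "\<lambda>p. k (fst p) (snd p)"]
      X_nonempty by blast
  have "k (fst p) (snd p) > 0" by (simp add: k_factor a_pos)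
  moreover have "k (fst p) (snd p) \<le> k x y" if "x \<in> X" "y \<in> X" for x y
    using p(2)[of "(x, y)"] that by simp
  moreover have "k (fst p) (snd p) \<le> 1"
  proof -
    have "(LINT x|\<mu>. k (fst p) (snd p)) \<le> (LINT x|\<mu>. k x (snd p))"
      using calculation(2) p(1)
      by (intro integral_mono integrable_if_continuous continuous_on_k continuous_on_const)
        (auto simp: space_\<mu>)
    then show ?thesis using p(1) by (auto simp: prob_space integral_k)
  qed
  ultimately show ?thesis by blast
qed

lemma linear_evl: "x \<in> X \<Longrightarrow> linear (\<lambda>\<phi>. evl \<phi> x)"
  using rkhs by (simp add: is_rkhs_def)

lemmas evl_simps = linear_add[OF linear_evl] linear_diff[OF linear_evl] linear_scale[OF linear_evl]
  linear_0[OF linear_evl]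

lemma evl_eqI: "(\<And>x. x \<in> X \<Longrightarrow> evl \<phi> x = evl \<psi> x) \<Longrightarrow> \<phi> = \<psi>"
  using rkhs unfolding is_rkhs_def by blast

lemma elem_of_eq: "(\<And>x. x \<in> X \<Longrightarrow> evl \<phi> x = u x) \<Longrightarrow> elem_of X evl u = \<phi>"
  unfolding elem_of_def by (intro the_equality) (auto intro: evl_eqI)

text \<open>The Riesz representer of evaluation at \<open>y\<close>.\<close>

definition kap :: "real ^ 'n \<Rightarrow> 'h" where "kap y = elem_of X evl (\<lambda>x. k x y)"

lemma
  assumes "y \<in> X"
  shows evl_kap: "x \<in> X \<Longrightarrow> evl (kap y) x = k x y"
    and inner_kap: "inner \<phi> (kap y) = evl \<phi> y"
proof -
  obtain \<kappa> where \<kappa>: "\<forall>x\<in>X. evl \<kappa> x = k x y" "\<forall>\<phi>. evl \<phi> y = inner \<phi> \<kappa>"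
    using rkhs assms unfolding is_rkhs_def by meson
  then have "kap y = \<kappa>" unfolding kap_def by (intro elem_of_eq) auto
  with \<kappa> show "x \<in> X \<Longrightarrow> evl (kap y) x = k x y" "inner \<phi> (kap y) = evl \<phi> y" by auto
qed

definition e :: "real ^ 'n \<Rightarrow> 'h" where "e y = (1 / a y) *\<^sub>R kap y"

lemma evl_eq_inner_e: "y \<in> X \<Longrightarrow> evl \<phi> y = a y * inner \<phi> (e y)"
  using a_pos[of y] by (simp add: e_def inner_kap)

sublocale exp_features X b e
proof
  show "inner (e x) (e y) = exp (b * inner x y)" if "x \<in> X" "y \<in> X" for x y
    using that a_pos[of x] a_pos[of y]
    by (simp add: e_def inner_kap evl_kap k_factor inner_commute)
  show "\<phi> = 0" if "\<And>y. y \<in> X \<Longrightarrow> inner \<phi> (e y) = 0" for \<phi>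
    using that by (intro evl_eqI) (simp add: evl_eq_inner_e)
qed (use b_pos closure_interior_X in auto)

lemma kap_eq: "kap x = a x *\<^sub>R e x"
  using a_pos[of x] by (simp add: e_def)

lemma continuous_on_kap: "continuous_on X kap"
  unfolding kap_eq by (intro continuous_intros continuous_on_a continuous_on_e)

lemma continuous_on_evl: "continuous_on X (evl \<phi>)"
proof (rule continuous_on_eq)
  show "continuous_on X (\<lambda>x. inner \<phi> (kap x))" by (intro continuous_intros continuous_on_kap)
qed (simp add: inner_kap)

text \<open>Evaluation at \<open>x\<close> is pairing with \<open>kap x\<close>, and
  \<open>kap\<close> is continuous on a compact set. The Hilbert norm therefore controls the
  supremum norm.\<close>

lemma evl_bound: "\<exists>C\<ge>0. \<forall>\<phi>. \<forall>x\<in>X. \<bar>evl \<phi> x\<bar> \<le> C * norm \<phi>"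
proof -
  obtain C where C: "\<And>x. x \<in> X \<Longrightarrow> norm (kap x) \<le> C"
    using bounded_on_X[OF continuous_on_kap] by blast
  have "\<bar>evl \<phi> x\<bar> \<le> C * norm \<phi>" if "x \<in> X" for \<phi> x
    using Cauchy_Schwarz_ineq2[of \<phi> "kap x"] mult_right_mono[OF C[OF that], of "norm \<phi>"]
    by (simp add: inner_kap[OF that] mult.commute)
  moreover have "C \<ge> 0" using C X_nonempty norm_ge_zero order_trans by blast
  ultimately show ?thesis by blast
qed

section \<open>Integral operators with kernel \<open>k\<close>\<close>

definition T :: "(real ^ 'n \<Rightarrow> real) \<Rightarrow> 'h" where
  "T g = elem_of X evl (\<lambda>y. LINT x|\<mu>. g x * k x y)"

text \<open>Integration of \<open>evl \<phi>\<close> against \<open>g\<close> is a bounded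
  functional of \<open>\<phi>\<close>; its Riesz vector, tested against \<open>kap y\<close>, has
  the values demanded of \<open>T g\<close>, so \<open>T g\<close> exists. \<open>T\<close> is thus
  adjoint to the inclusion into square-integrable functions.\<close>

lemma inner_T:
  assumes g: "continuous_on X g"
  shows "inner (T g) \<phi> = (LINT x|\<mu>. g x * evl \<phi> x)"
proof -
  obtain C where C: "\<And>\<phi> x. x \<in> X \<Longrightarrow> \<bar>evl \<phi> x\<bar> \<le> C * norm \<phi>" using evl_bound by blast
  obtain B where B: "\<And>x. x \<in> X \<Longrightarrow> norm (g x) \<le> B" using bounded_on_X[OF g] by blast
  have B0: "B \<ge> 0" using B X_nonempty norm_ge_zero order_trans by blast
  have int: "integrable \<mu> (\<lambda>x. g x * evl \<phi> x)" for \<phi>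
    by (intro integrable_if_continuous continuous_intros g continuous_on_evl)
  have "bounded_linear (\<lambda>\<phi>. LINT x|\<mu>. g x * evl \<phi> x)"
  proof (rule bounded_linear_intro)
    fix \<phi> \<psi> r
    have "(LINT x|\<mu>. g x * evl (\<phi> + \<psi>) x) = (LINT x|\<mu>. g x * evl \<phi> x + g x * evl \<psi> x)"
      by (rule Bochner_Integration.integral_cong) (auto simp: space_\<mu> evl_simps distrib_left)
    then show "(LINT x|\<mu>. g x * evl (\<phi> + \<psi>) x) = (LINT x|\<mu>. g x * evl \<phi> x) + (LINT x|\<mu>. g x * evl \<psi> x)"
      by (simp add: int)
    have "(LINT x|\<mu>. g x * evl (r *\<^sub>R \<phi>) x) = (LINT x|\<mu>. r * (g x * evl \<phi> x))"
      by (rule Bochner_Integration.integral_cong) (auto simp: space_\<mu> evl_simps)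
    then show "(LINT x|\<mu>. g x * evl (r *\<^sub>R \<phi>) x) = r *\<^sub>R (LINT x|\<mu>. g x * evl \<phi> x)" by simp
    have "\<bar>LINT x|\<mu>. g x * evl \<phi> x\<bar> \<le> B * (C * norm \<phi>)"
      using B C B0
      by (intro abs_integral_le continuous_intros g continuous_on_evl) (auto simp: abs_mult intro!: mult_mono)
    then show "norm (LINT x|\<mu>. g x * evl \<phi> x) \<le> norm \<phi> * (B * C)" by (simp add: mult_ac)
  qed
  then obtain h where h: "\<And>\<phi>. (LINT x|\<mu>. g x * evl \<phi> x) = inner \<phi> h"
    using riesz_representation by blast
  have "T g = h"
    unfolding T_def
  proof (rule elem_of_eq)
    fix y assume y: "y \<in> X"
    have "evl h y = (LINT x|\<mu>. g x * evl (kap y) x)" using y by (simp add: h inner_kap inner_commute[of "kap y"])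
    also have "\<dots> = (LINT x|\<mu>. g x * k x y)"
      by (rule Bochner_Integration.integral_cong) (auto simp: space_\<mu> evl_kap y)
    finally show "evl h y = (LINT x|\<mu>. g x * k x y)" .
  qed
  then show ?thesis by (simp add: h inner_commute)
qed

lemma evl_T:
  assumes "continuous_on X g" "y \<in> X"
  shows "evl (T g) y = (LINT x|\<mu>. g x * k x y)"
proof -
  have "evl (T g) y = (LINT x|\<mu>. g x * evl (kap y) x)"
    using assms by (simp add: inner_kap[symmetric] inner_T)
  also have "\<dots> = (LINT x|\<mu>. g x * k x y)"
    by (rule Bochner_Integration.integral_cong) (auto simp: space_\<mu> evl_kap assms)
  finally show ?thesis .
qed

subsection \<open>The averaging operator\<close>

text \<open>The normalisation \<open>integral_k\<close> makes this the constant function 1. Pairing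
  with it is the mean under \<open>\<mu>\<close>, so orthogonality to it encodes mean zero.\<close>

definition one :: 'h where "one = T (\<lambda>_. 1)"

lemma evl_one: "y \<in> X \<Longrightarrow> evl one y = 1"
  by (simp add: one_def evl_T integral_k)

lemma inner_one: "inner one \<phi> = (LINT x|\<mu>. evl \<phi> x)"
  by (simp add: one_def inner_T)

lemma inner_one_one: "inner one one = 1"
proof -
  have "inner one one = (LINT x|\<mu>. 1)"
    unfolding inner_one by (rule Bochner_Integration.integral_cong) (auto simp: space_\<mu> evl_one)
  then show ?thesis by (simp add: prob_space)
qed

lemma elem_of_one: "elem_of X evl (\<lambda>_. 1) = one"
  by (rule elem_of_eq) (simp add: evl_one)

definition K :: "'h \<Rightarrow> 'h" where "K \<phi> = T (evl \<phi>)"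

lemma K_op_eq: "K_op X \<mu> k evl = K"
  by (simp add: fun_eq_iff K_op_def K_def T_def)

lemma inner_K: "inner (K \<phi>) \<psi> = (LINT x|\<mu>. evl \<phi> x * evl \<psi> x)"
  by (simp add: K_def inner_T continuous_on_evl)

lemma K_symmetric: "inner (K \<phi>) \<psi> = inner \<phi> (K \<psi>)"
  by (simp add: inner_K inner_commute[of \<phi>] mult.commute)

lemma K_one: "K one = one"
proof (rule evl_eqI)
  fix y assume y: "y \<in> X"
  have "evl (K one) y = (LINT x|\<mu>. evl one x * k x y)"
    by (simp add: K_def evl_T continuous_on_evl y)
  also have "\<dots> = (LINT x|\<mu>. k x y)"
    by (rule Bochner_Integration.integral_cong) (auto simp: space_\<mu> evl_one)
  finally show "evl (K one) y = evl one y" by (simp add: integral_k evl_one y)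
qed

text \<open>Pairing \<open>K \<phi>\<close> with itself gives the integral of
  \<open>evl \<phi>\<close> times \<open>evl (K \<phi>)\<close>; bounding the second factor by
  \<open>C * norm (K \<phi>)\<close> and cancelling the norm leaves only the supremum bound
  \<open>B\<close>.\<close>

lemma norm_K_le:
  assumes C: "\<And>\<phi> x. x \<in> X \<Longrightarrow> \<bar>evl \<phi> x\<bar> \<le> C * norm \<phi>" and B: "\<And>x. x \<in> X \<Longrightarrow> \<bar>evl \<phi> x\<bar> \<le> B"
  shows "norm (K \<phi>) \<le> B * C"
proof (cases "K \<phi> = 0")
  case False
  have B0: "B \<ge> 0" using B X_nonempty abs_ge_zero order_trans by blast
  have "(norm (K \<phi>))\<^sup>2 = \<bar>LINT x|\<mu>. evl \<phi> x * evl (K \<phi>) x\<bar>"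
    by (simp add: power2_norm_eq_inner inner_K[symmetric])
  also have "\<dots> \<le> B * (C * norm (K \<phi>))"
    using B C B0
    by (intro abs_integral_le continuous_intros continuous_on_evl) (auto simp: abs_mult intro!: mult_mono)
  finally show ?thesis using False by (simp add: power2_eq_square)
next
  case True
  have "B \<ge> 0" using B X_nonempty abs_ge_zero order_trans by blast
  obtain x where x: "x \<in> X" using X_nonempty by blast
  have "one \<noteq> 0" using evl_one[OF x] evl_simps(4)[OF x] by auto
  then have "C \<ge> 0" using C[OF x, of one] by (simp add: evl_one[OF x]) (smt (verit) mult_nonpos_nonneg norm_ge_zero)
  with True \<open>B \<ge> 0\<close> show ?thesis by simp
qed

lemma linear_K: "linear K"
proof (rule linearI)
  have "inner (K (\<phi> + \<psi>)) \<theta> = inner (K \<phi> + K \<psi>) \<theta>" for \<phi> \<psi> \<theta>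
    by (simp add: K_symmetric inner_add_left)
  then show "K (\<phi> + \<psi>) = K \<phi> + K \<psi>" for \<phi> \<psi> by (metis vector_eq_rdot)
  have "inner (K (r *\<^sub>R \<phi>)) \<theta> = inner (r *\<^sub>R K \<phi>) \<theta>" for \<phi> \<theta> r
    by (simp add: K_symmetric)
  then show "K (r *\<^sub>R \<phi>) = r *\<^sub>R K \<phi>" for \<phi> r by (metis vector_eq_rdot)
qed

lemma bounded_linear_K: "bounded_linear K"
proof -
  obtain C where C: "\<And>\<phi> x. x \<in> X \<Longrightarrow> \<bar>evl \<phi> x\<bar> \<le> C * norm \<phi>" using evl_bound by blast
  have "norm (K \<phi>) \<le> norm \<phi> * (C * C)" for \<phi>
    using norm_K_le[OF C, of \<phi> "C * norm \<phi>"] C[of _ \<phi>] by (simp add: mult_ac)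
  then show ?thesis
    using linear_K by (intro bounded_linear_intro) (auto simp: linear_add linear_scale)
qed

lemma inner_one_K: "inner one (K \<phi>) = inner one \<phi>"
  by (simp add: K_symmetric[symmetric] K_one)

text \<open>Since \<open>\<integral>\<phi> d\<mu> = 0\<close>, the kernel \<open>k\<close> may be replaced by \<open>k - \<delta>\<close>, which is nonnegative and
  has integral \<open>1 - \<delta>\<close>.\<close>

lemma K_contracts:
  assumes \<delta>: "\<And>x y. x \<in> X \<Longrightarrow> y \<in> X \<Longrightarrow> \<delta> \<le> k x y"
    and "inner one \<phi> = 0" and B: "\<And>x. x \<in> X \<Longrightarrow> \<bar>evl \<phi> x\<bar> \<le> B" and y: "y \<in> X"
  shows "\<bar>evl (K \<phi>) y\<bar> \<le> (1 - \<delta>) * B"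
proof -
  have B0: "B \<ge> 0" using B X_nonempty abs_ge_zero order_trans by blast
  have int: "integrable \<mu> (\<lambda>x. evl \<phi> x * k x y)" "integrable \<mu> (evl \<phi>)" "integrable \<mu> (\<lambda>x. k x y)"
    "integrable \<mu> (\<lambda>x. evl \<phi> x * (k x y - \<delta>))"
    by (intro integrable_if_continuous continuous_intros continuous_on_evl continuous_on_k)+
  have "evl (K \<phi>) y = (LINT x|\<mu>. evl \<phi> x * k x y) - \<delta> * (LINT x|\<mu>. evl \<phi> x)"
    using assms(2) by (simp add: K_def evl_T continuous_on_evl y inner_one)
  also have "\<dots> = (LINT x|\<mu>. evl \<phi> x * (k x y - \<delta>))"
    by (simp add: right_diff_distrib int mult.commute[of _ \<delta>])
  also have "\<bar>\<dots>\<bar> \<le> (LINT x|\<mu>. \<bar>evl \<phi> x * (k x y - \<delta>)\<bar>)" by simp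
  also have "\<dots> \<le> (LINT x|\<mu>. B * (k x y - \<delta>))"
    using \<delta> B B0 y by (intro integral_mono integrable_abs int)
      (auto simp: space_\<mu> abs_mult int intro!: mult_mono)
  also have "\<dots> = (1 - \<delta>) * B" by (simp add: int integral_k y prob_space)
  finally show ?thesis .
qed

section \<open>The operator \<open>A\<close> and its inverse modulo constants\<close>

definition A :: "'h \<Rightarrow> 'h" where "A \<phi> = \<phi> - K (K \<phi>)"

lemma linear_A: "linear A"
  unfolding A_def
  by (rule linearI) (auto simp: linear_add[OF linear_K] linear_scale[OF linear_K] algebra_simps)

lemma A_one: "A one = 0"
  by (simp add: A_def K_one)

lemma A_symmetric: "inner (A \<phi>) \<psi> = inner \<phi> (A \<psi>)"
  by (simp add: A_def inner_diff_left inner_diff_right K_symmetric)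

text \<open>Mean zero is part of the induction because each use of \<open>K_contracts\<close>
  requires it; \<open>K\<close> preserves the mean.\<close>

lemma powers_K_bound:
  assumes \<delta>: "\<And>x y. x \<in> X \<Longrightarrow> y \<in> X \<Longrightarrow> \<delta> \<le> k x y"
    and "inner one \<phi> = 0" and B: "\<And>x. x \<in> X \<Longrightarrow> \<bar>evl \<phi> x\<bar> \<le> B"
  shows "inner one ((K ^^ n) \<phi>) = 0 \<and> (\<forall>x\<in>X. \<bar>evl ((K ^^ n) \<phi>) x\<bar> \<le> (1 - \<delta>) ^ n * B)"
proof (induction n)
  case (Suc n)
  then show ?case using K_contracts[OF \<delta>, of "(K ^^ n) \<phi>" "(1 - \<delta>) ^ n * B"]
    by (simp add: inner_one_K mult.assoc)
qed (use assms in simp)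

text \<open>Pairing with \<open>one\<close> forces \<open>c = 0\<close>, as \<open>A\<close> is
  symmetric and kills \<open>one\<close>. After removal of the mean, \<open>\<psi>\<close> equals
  all its even iterates under \<open>K\<close>, whose supremum decays geometrically.\<close>

lemma ker_A:
  assumes "A \<phi> = c *\<^sub>R one"
  shows "\<exists>d. \<phi> = d *\<^sub>R one"
proof -
  obtain \<delta> where \<delta>: "\<delta> > 0" "\<delta> \<le> 1" "\<And>x y. x \<in> X \<Longrightarrow> y \<in> X \<Longrightarrow> \<delta> \<le> k x y" using k_lower_bound by blast
  have "c = inner one (A \<phi>)" by (simp add: assms inner_one_one)
  also have "\<dots> = 0" by (simp add: A_symmetric[symmetric] A_one)
  finally have "A \<phi> = 0" using assms by simp
  define \<psi> where "\<psi> = \<phi> - inner one \<phi> *\<^sub>R one"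
  have "A \<psi> = 0" using \<open>A \<phi> = 0\<close> by (simp add: \<psi>_def linear_diff[OF linear_A] linear_scale[OF linear_A] A_one)
  then have KK: "K (K \<psi>) = \<psi>" by (simp add: A_def)
  have pow: "(K ^^ (2 * n)) \<psi> = \<psi>" for n by (induction n) (auto simp: KK)
  obtain C where C: "\<And>\<phi> x. x \<in> X \<Longrightarrow> \<bar>evl \<phi> x\<bar> \<le> C * norm \<phi>" using evl_bound by blast
  have mean: "inner one \<psi> = 0" by (simp add: \<psi>_def inner_diff_right inner_one_one)
  have "\<psi> = 0"
  proof (rule evl_eqI)
    fix x assume x: "x \<in> X"
    have "\<bar>evl \<psi> x\<bar> \<le> (1 - \<delta>) ^ (2 * n) * (C * norm \<psi>)" for n
      using powers_K_bound[OF \<delta>(3) mean C, of "2 * n"] x unfolding pow by blast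
    moreover have "(\<lambda>n. (1 - \<delta>) ^ (2 * n) * (C * norm \<psi>)) \<longlonglongrightarrow> 0"
    proof -
      have "(1 - \<delta>)\<^sup>2 < 1" using \<delta> by (simp add: power_less_one_iff)
      then show ?thesis unfolding power_mult by (intro tendsto_mult_left_zero LIMSEQ_realpow_zero) auto
    qed
    ultimately have "\<bar>evl \<psi> x\<bar> \<le> 0" by (intro LIMSEQ_le_const) auto
    then show "evl \<psi> x = evl 0 x" using x by (simp add: evl_simps)
  qed
  then show ?thesis by (auto simp: \<psi>_def)
qed

text \<open>The Neumann series of \<open>id - K\<^sup>2\<close> converges in \<open>'h\<close> because \<open>K\<close> contracts the supremum norm
  on functions of mean zero and is bounded from the supremum norm to the norm of \<open>'h\<close>.\<close>

lemma A_surj: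
  assumes "inner one h = 0"
  shows "\<exists>\<psi>. A \<psi> = h"
proof -
  obtain \<delta> where \<delta>: "\<delta> > 0" "\<delta> \<le> 1" "\<And>x y. x \<in> X \<Longrightarrow> y \<in> X \<Longrightarrow> \<delta> \<le> k x y" using k_lower_bound by blast
  obtain C where C: "\<And>\<phi> x. x \<in> X \<Longrightarrow> \<bar>evl \<phi> x\<bar> \<le> C * norm \<phi>" using evl_bound by blast
  define d where "d n = (K ^^ (2 * n)) h" for n
  define r where "r = (1 - \<delta>)\<^sup>2"
  have r: "0 \<le> r" "r < 1" using \<delta> by (simp_all add: r_def power_less_one_iff)
  \<comment> \<open>The outermost \<open>K\<close> is spent on passing from the supremum norm to the
    Hilbert norm, so only \<open>Suc (2 * n)\<close> applications contract. The term
    \<open>d 0 = h\<close> has no such \<open>K\<close>, hence the shifted index.\<close>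
  have norm_d: "norm (d (Suc n)) \<le> (1 - \<delta>) * C * norm h * C * r ^ n" for n
  proof -
    have "norm (d (Suc n)) \<le> (1 - \<delta>) ^ Suc (2 * n) * (C * norm h) * C"
      using norm_K_le[OF C, of "(K ^^ Suc (2 * n)) h"] powers_K_bound[OF \<delta>(3) assms C, of "Suc (2 * n)"]
      by (simp add: d_def)
    also have "\<dots> = (1 - \<delta>) * C * norm h * C * r ^ n"
      unfolding power_Suc r_def power_mult by simp
    finally show ?thesis .
  qed
  define s where "s n = (\<Sum>i<n. d i)" for n
  define t where "t n = (\<Sum>i<n. (1 - \<delta>) * C * norm h * C * r ^ i)" for n
  have "convergent t"
  proof -
    have "summable (\<lambda>i. (1 - \<delta>) * C * norm h * C * r ^ i)"
      using r by (intro summable_mult summable_geometric) auto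
    then show ?thesis unfolding t_def summable_iff_convergent .
  qed
  then have "Cauchy (\<lambda>n. s (Suc n))"
    using norm_d by (intro Cauchy_if_step_dominated[of _ t]) (simp_all add: s_def t_def)
  then obtain \<psi> where "(\<lambda>n. s (Suc n)) \<longlonglongrightarrow> \<psi>" using Cauchy_convergent convergent_def by blast
  then have s: "s \<longlonglongrightarrow> \<psi>" by (simp only: filterlim_sequentially_Suc)
  \<comment> \<open>The recursion turns into the fixed-point equation
    \<open>\<psi> = h + K (K \<psi>)\<close> in the limit.\<close>
  have "s (Suc n) = h + K (K (s n))" for n
  proof -
    have "s (Suc n) = d 0 + (\<Sum>i<n. d (Suc i))" unfolding s_def by (rule sum.lessThan_Suc_shift)
    then show ?thesis by (simp add: d_def s_def linear_sum[OF linear_K])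
  qed
  moreover have "(\<lambda>n. h + K (K (s n))) \<longlonglongrightarrow> h + K (K \<psi>)"
    by (intro tendsto_intros bounded_linear.tendsto[OF bounded_linear_K] s)
  ultimately have "(\<lambda>n. s (Suc n)) \<longlonglongrightarrow> h + K (K \<psi>)" by simp
  then have "s \<longlonglongrightarrow> h + K (K \<psi>)" by (simp only: filterlim_sequentially_Suc)
  then have "\<psi> = h + K (K \<psi>)" using s LIMSEQ_unique by blast
  then have "A \<psi> = h" unfolding A_def by (metis add_diff_cancel_right')
  then show ?thesis ..
qed

subsection \<open>Gradients and coordinate functions\<close>

text \<open>\<open>N v x\<close> represents the functional \<open>\<phi> \<mapsto> v \<bullet> \<nabla>\<phi> x\<close>; it is the derivative at \<open>x\<close> in direction
  \<open>v\<close> of \<open>kap\<close>.  Differentiability of the factor \<open>a\<close> is inherited from \<open>e\<close>, since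
  \<open>1 = evl one y = a y * inner one (e y)\<close>.\<close>

definition N :: "real ^ 'n \<Rightarrow> real ^ 'n \<Rightarrow> 'h" where
  "N v x = a x *\<^sub>R D v x - (a x * inner one (D v x)) *\<^sub>R kap x"

lemma linear_N: "x \<in> X \<Longrightarrow> linear (\<lambda>v. N v x)"
  by (rule linearI)
    (simp_all add: N_def linear_add[OF linear_D] linear_scale[OF linear_D] algebra_simps)

lemma continuous_on_N: "continuous_on X (N v)"
  unfolding N_def
  by (intro continuous_intros continuous_on_a continuous_on_D continuous_on_kap)

lemma interior_X: "x \<in> interior X \<Longrightarrow> x \<in> X"
  using interior_subset by blast

lemma has_derivative_evl:
  assumes x: "x \<in> interior X"
  shows "(evl \<phi> has_derivative (\<lambda>h. inner \<phi> (N h x))) (at x)"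
proof -
  have xX: "x \<in> X" using x by (rule interior_X)
  have 1: "a y * inner one (e y) = 1" if "y \<in> X" for y
    using that by (simp add: evl_eq_inner_e[symmetric] evl_one)
  then have nz: "inner one (e y) \<noteq> 0" if "y \<in> X" for y using that by fastforce
  have a_eq: "a y = 1 / inner one (e y)" if "y \<in> X" for y
    using 1[OF that] nz[OF that] by (simp add: field_simps)
  \<comment> \<open>With \<open>a\<close> replaced by the reciprocal of
    \<open>inner one (e y)\<close>, only derivatives of \<open>e\<close> enter and the quotient rule
    applies.\<close>
  have "((\<lambda>y. inner \<phi> (e y) / inner one (e y)) has_derivative
      (\<lambda>h. (inner \<phi> (D h x) * inner one (e x) - inner \<phi> (e x) * inner one (D h x))
        / (inner one (e x) * inner one (e x)))) (at x)"
    by (intro has_derivative_divide' has_derivative_inner_right has_derivative_e x nz xX)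
  also have "(\<lambda>h. (inner \<phi> (D h x) * inner one (e x) - inner \<phi> (e x) * inner one (D h x))
        / (inner one (e x) * inner one (e x))) = (\<lambda>h. inner \<phi> (N h x))"
  proof
    fix h
    have "inner \<phi> (N h x) = a x * inner \<phi> (D h x) - a x * inner one (D h x) * (a x * inner \<phi> (e x))"
      by (simp add: N_def inner_diff_right kap_eq)
    then show "(inner \<phi> (D h x) * inner one (e x) - inner \<phi> (e x) * inner one (D h x))
        / (inner one (e x) * inner one (e x)) = inner \<phi> (N h x)"
      using nz[OF xX] by (simp add: a_eq[OF xX] divide_simps)
  qed
  finally show ?thesis
    by (rule has_derivative_transform_within_open[OF _ open_interior x])
      (simp_all add: interior_X evl_eq_inner_e a_eq)
qed

text \<open>The candidate gradient, assembled from its components; it is defined at boundary points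
  too, where \<open>gradient_on\<close> asks for a continuous extension.\<close>

definition G :: "'h \<Rightarrow> real ^ 'n \<Rightarrow> real ^ 'n" where
  "G \<phi> x = (\<Sum>i\<in>Basis. inner \<phi> (N i x) *\<^sub>R i)"

lemma inner_G:
  assumes "x \<in> X"
  shows "inner v (G \<phi> x) = inner \<phi> (N v x)"
proof -
  have "inner \<phi> (N (\<Sum>i\<in>Basis. inner v i *\<^sub>R i) x) = (\<Sum>i\<in>Basis. inner v i * inner \<phi> (N i x))"
    by (simp only: linear_sum[OF linear_N[OF assms]] linear_scale[OF linear_N[OF assms]]
        inner_sum_right inner_scaleR_right)
  then show ?thesis by (simp add: euclidean_representation G_def inner_sum_right mult.commute)
qed

lemma gradient_evl:
  assumes "x \<in> X"
  shows "gradient_on X (evl \<phi>) x = G \<phi> x"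
proof (rule gradient_on_eq[OF closure_interior_X _ _ assms])
  show "continuous_on X (G \<phi>)"
    unfolding G_def by (intro continuous_intros continuous_on_N)
  show "GDERIV (evl \<phi>) x :> G \<phi> x" if "x \<in> interior X" for x
    using has_derivative_evl[OF that, of \<phi>] that
    unfolding gderiv_def by (simp add: inner_G interior_X)
qed

lemma integral_inner_gradient:
  "(LINT x|\<mu>. inner v (gradient_on X (evl \<phi>) x)) = (LINT x|\<mu>. inner \<phi> (N v x))"
  by (rule Bochner_Integration.integral_cong) (auto simp: space_\<mu> gradient_evl inner_G)

text \<open>\<open>Blinfun\<close> returns the intended functional only for a bounded linear map;
  here the bound comes from continuity of \<open>N v\<close> on the compact set
  \<open>X\<close>.\<close>

lemma neg_div_gradient:
  "blinfun_apply (neg_div X \<mu> evl v) \<phi> = (LINT x|\<mu>. inner v (gradient_on X (evl \<phi>) x))"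
proof -
  obtain B where B: "\<And>x. x \<in> X \<Longrightarrow> norm (N v x) \<le> B" using bounded_on_X[OF continuous_on_N] by blast
  have cont: "continuous_on X (\<lambda>x. inner \<phi> (N v x))" for \<phi>
    by (intro continuous_intros continuous_on_N)
  have "bounded_linear (\<lambda>\<phi>. LINT x|\<mu>. inner \<phi> (N v x))"
  proof (rule bounded_linear_intro)
    fix \<phi> \<psi> r
    show "(LINT x|\<mu>. inner (\<phi> + \<psi>) (N v x)) = (LINT x|\<mu>. inner \<phi> (N v x)) + (LINT x|\<mu>. inner \<psi> (N v x))"
      by (simp add: inner_add_left integrable_if_continuous[OF cont])
    show "(LINT x|\<mu>. inner (r *\<^sub>R \<phi>) (N v x)) = r *\<^sub>R (LINT x|\<mu>. inner \<phi> (N v x))" by simp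
    have "\<bar>inner \<phi> (N v x)\<bar> \<le> norm \<phi> * B" if "x \<in> X" for x
      using Cauchy_Schwarz_ineq2[of \<phi> "N v x"] mult_left_mono[OF B[OF that], of "norm \<phi>"] by simp
    then show "norm (LINT x|\<mu>. inner \<phi> (N v x)) \<le> norm \<phi> * B"
      using abs_integral_le[OF cont] by simp
  qed
  then show ?thesis
    unfolding neg_div_def integral_inner_gradient by (simp add: bounded_linear_Blinfun_apply)
qed

lemma neg_div_eq: "blinfun_apply (neg_div X \<mu> evl v) \<phi> = (LINT x|\<mu>. inner \<phi> (N v x))"
  by (simp add: neg_div_gradient integral_inner_gradient)

lemma evl_N:
  assumes x: "x \<in> X" and y: "y \<in> X"
  shows "evl (N v x) y = b * (inner v y * k x y - evl (T (inner v)) x * k x y)"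
proof -
  have D: "a x * evl (D v x) y = b * (inner v y * k y x)" if "y \<in> X" for y
    using x that by (simp add: evl_eq_inner_e inner_D_e k_factor inner_commute[of y x])
  \<comment> \<open>Pairing with \<open>one\<close> integrates over \<open>y\<close>, which turns
    the correction term of \<open>N\<close> into an average of \<open>inner v\<close> under the
    kernel.\<close>
  have "a x * inner one (D v x) = (LINT y|\<mu>. a x * evl (D v x) y)" by (simp add: inner_one)
  also have "\<dots> = (LINT y|\<mu>. b * (inner v y * k y x))"
    by (rule Bochner_Integration.integral_cong) (auto simp: space_\<mu> D)
  also have "\<dots> = b * evl (T (inner v)) x"
    using x by (simp add: evl_T continuous_intros)
  finally show ?thesis
    using x y D[OF y] by (simp add: N_def evl_simps evl_kap k_commute[of y x] algebra_simps)
qed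

text \<open>The identity \<open>H[- div (v \<mu>)] = b (id - K\<^sup>2)[v \<bullet> id]\<close>; read from right to left it shows that
  \<open>v \<bullet> id\<close> belongs to the space.\<close>

lemma ex_lin:
  "\<exists>\<phi>. (\<forall>x\<in>X. evl \<phi> x = inner v x) \<and>
    (\<forall>\<psi>. blinfun_apply (neg_div X \<mu> evl v) \<psi> = inner \<psi> (A (b *\<^sub>R \<phi>)))"
proof -
  obtain h where h: "\<And>\<psi>. blinfun_apply (neg_div X \<mu> evl v) \<psi> = inner \<psi> h"
    using riesz_representation[OF blinfun.bounded_linear_right[of "neg_div X \<mu> evl v"]] by blast
  have cv: "continuous_on X (inner v)" by (intro continuous_intros)
  \<comment> \<open>This is the averaging operator applied twice to \<open>inner v\<close>, written
    with \<open>T\<close> while membership of \<open>inner v\<close> in the space is still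
    open.\<close>
  define \<kappa> where "\<kappa> = T (evl (T (inner v)))"
  have evl_h: "evl h y = b * (inner v y - evl \<kappa> y)" if y: "y \<in> X" for y
  proof -
    have "evl h y = (LINT x|\<mu>. inner (kap y) (N v x))"
      using y by (simp add: inner_kap[symmetric] inner_commute[of h] h[symmetric] neg_div_eq)
    also have "\<dots> = (LINT x|\<mu>. b * (inner v y * k x y - evl (T (inner v)) x * k x y))"
      by (rule Bochner_Integration.integral_cong)
        (auto simp: space_\<mu> inner_commute[of "kap y"] inner_kap y evl_N)
    also have "\<dots> = b * (inner v y * (LINT x|\<mu>. k x y) - (LINT x|\<mu>. evl (T (inner v)) x * k x y))"
      by (simp add: integrable_if_continuous continuous_on_k continuous_on_evl continuous_on_mult)
    finally show ?thesis using y by (simp add: \<kappa>_def integral_k evl_T continuous_on_evl)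
  qed
  \<comment> \<open>The equation \<open>evl_h\<close> solved for \<open>inner v\<close>.\<close>
  define \<phi> where "\<phi> = (1 / b) *\<^sub>R h + \<kappa>"
  have \<phi>: "evl \<phi> x = inner v x" if "x \<in> X" for x
    using that b_pos by (simp add: \<phi>_def evl_simps evl_h)
  have "T (evl \<phi>) = T (inner v)"
  proof -
    have "inner (T (evl \<phi>)) \<psi> = inner (T (inner v)) \<psi>" for \<psi>
      unfolding inner_T[OF cv] inner_T[OF continuous_on_evl]
      by (rule Bochner_Integration.integral_cong) (auto simp: space_\<mu> \<phi>)
    then show ?thesis by (metis vector_eq_rdot)
  qed
  then have "K (K \<phi>) = \<kappa>" by (simp add: K_def \<kappa>_def)
  then have "h = A (b *\<^sub>R \<phi>)"
    using b_pos by (simp add: linear_scale[OF linear_A]) (simp add: A_def \<phi>_def)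
  with \<phi> h show ?thesis by blast
qed

definition lin :: "real ^ 'n \<Rightarrow> 'h" where "lin v = elem_of X evl (inner v)"

lemma
  shows evl_lin: "x \<in> X \<Longrightarrow> evl (lin v) x = inner v x"
    and neg_div_lin: "blinfun_apply (neg_div X \<mu> evl v) \<psi> = inner \<psi> (A (b *\<^sub>R lin v))"
proof -
  obtain \<phi> where \<phi>: "\<forall>x\<in>X. evl \<phi> x = inner v x"
    "\<forall>\<psi>. blinfun_apply (neg_div X \<mu> evl v) \<psi> = inner \<psi> (A (b *\<^sub>R \<phi>))"
    using ex_lin by blast
  then have "lin v = \<phi>" unfolding lin_def by (intro elem_of_eq) auto
  with \<phi> show "x \<in> X \<Longrightarrow> evl (lin v) x = inner v x"
    "blinfun_apply (neg_div X \<mu> evl v) \<psi> = inner \<psi> (A (b *\<^sub>R lin v))" by auto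
qed

lemma lin_eq_sum: "lin v = (\<Sum>i\<in>UNIV. (v $ i) *\<^sub>R lin (axis i 1))"
proof (rule evl_eqI)
  fix x assume x: "x \<in> X"
  have "evl (\<Sum>i\<in>UNIV. (v $ i) *\<^sub>R lin (axis i 1)) x = (\<Sum>i\<in>UNIV. v $ i * x $ i)"
    by (simp add: linear_sum[OF linear_evl[OF x]] evl_simps x evl_lin inner_axis')
  then show "evl (lin v) x = evl (\<Sum>i\<in>UNIV. (v $ i) *\<^sub>R lin (axis i 1)) x"
    by (simp add: evl_lin x inner_vec_def)
qed

text \<open>The gradient of \<open>lin v\<close> is the constant \<open>v\<close>, and
  \<open>\<mu>\<close> has mass 1.\<close>

lemma neg_div_of_lin: "blinfun_apply (neg_div X \<mu> evl w) (lin v) = inner w v"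
proof -
  have "gradient_on X (evl (lin v)) x = v" if "x \<in> X" for x
  proof (rule gradient_on_eq[OF closure_interior_X _ _ that])
    show "GDERIV (evl (lin v)) x :> v" if x: "x \<in> interior X" for x
    proof -
      have "((\<lambda>y. inner v y) has_derivative (\<lambda>h. inner h v)) (at x)"
        by (auto intro!: derivative_eq_intros simp: inner_commute)
      then show ?thesis
        unfolding gderiv_def
        by (rule has_derivative_transform_within_open[OF _ open_interior x])
          (simp_all add: interior_X evl_lin)
    qed
  qed simp
  then have "(LINT x|\<mu>. inner w (gradient_on X (evl (lin v)) x)) = (LINT x|\<mu>. inner w v)"
    by (intro Bochner_Integration.integral_cong) (auto simp: space_\<mu>)
  then show ?thesis by (simp add: neg_div_gradient prob_space)
qed

lemma dual0_iff: "\<sigma> \<in> dual0 X evl \<longleftrightarrow> blinfun_apply \<sigma> one = 0"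
  by (simp add: dual0_def elem_of_one)

lemma neg_div_in_dual0: "neg_div X \<mu> evl v \<in> dual0 X evl"
  by (simp add: dual0_iff neg_div_lin A_symmetric[symmetric] A_one)

lemma diff_in_dual0: "\<sigma> \<in> dual0 X evl \<Longrightarrow> \<tau> \<in> dual0 X evl \<Longrightarrow> \<sigma> - \<tau> \<in> dual0 X evl"
  by (simp add: dual0_iff blinfun.diff_left)

subsection \<open>The metric on the dual of the quotient\<close>

abbreviation cls :: "'h \<Rightarrow> 'h set" where "cls \<phi> \<equiv> const_rel X evl `` {\<phi>}"

lemma const_rel_iff: "(\<phi>, \<psi>) \<in> const_rel X evl \<longleftrightarrow> (\<exists>c. \<phi> - \<psi> = c *\<^sub>R one)"
proof -
  have "(\<forall>x\<in>X. evl \<phi> x - evl \<psi> x = c) \<longleftrightarrow> \<phi> - \<psi> = c *\<^sub>R one" for c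
  proof
    show "\<phi> - \<psi> = c *\<^sub>R one" if "\<forall>x\<in>X. evl \<phi> x - evl \<psi> x = c"
      using that by (intro evl_eqI) (simp add: evl_simps evl_one)
    show "\<forall>x\<in>X. evl \<phi> x - evl \<psi> x = c" if "\<phi> - \<psi> = c *\<^sub>R one"
    proof
      fix x assume x: "x \<in> X"
      have "evl (\<phi> - \<psi>) x = evl (c *\<^sub>R one) x" by (simp only: that)
      then show "evl \<phi> x - evl \<psi> x = c" by (simp add: evl_simps evl_one x)
    qed
  qed
  then show ?thesis by (simp add: const_rel_def)
qed

lemma equiv_const_rel: "equiv UNIV (const_rel X evl)"
proof (rule equivI)
  show "sym (const_rel X evl)"
    by (rule symI) (metis const_rel_iff minus_diff_eq scaleR_minus_left)
  show "trans (const_rel X evl)"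
    by (rule transI) (metis (no_types) const_rel_iff diff_add_cancel add_diff_eq scaleR_add_left)
qed (auto simp: refl_on_def const_rel_iff intro: exI[of _ 0])

lemma cls_eq_iff: "cls \<phi> = cls \<psi> \<longleftrightarrow> (\<exists>c. \<phi> - \<psi> = c *\<^sub>R one)"
  using eq_equiv_class_iff[OF equiv_const_rel] by (simp add: const_rel_iff)

lemma quot_space_eq: "quot_space X evl = range cls"
  by (auto simp: quot_space_def quotient_def)

lemma fun_class_eq:
  assumes "\<And>x. x \<in> X \<Longrightarrow> evl \<phi> x = u x"
  shows "fun_class X evl u = cls \<phi>"
proof -
  have "(\<exists>a. \<forall>x\<in>X. evl \<psi> x - u x = a) \<longleftrightarrow> (\<exists>a. \<forall>x\<in>X. evl \<phi> x - evl \<psi> x = a)" for \<psi>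
  proof
    assume "\<exists>a. \<forall>x\<in>X. evl \<psi> x - u x = a"
    then obtain a where "\<forall>x\<in>X. evl \<psi> x - u x = a" ..
    then show "\<exists>a. \<forall>x\<in>X. evl \<phi> x - evl \<psi> x = a" using assms by (intro exI[of _ "- a"]) auto
  next
    assume "\<exists>a. \<forall>x\<in>X. evl \<phi> x - evl \<psi> x = a"
    then obtain a where "\<forall>x\<in>X. evl \<phi> x - evl \<psi> x = a" ..
    then show "\<exists>a. \<forall>x\<in>X. evl \<psi> x - u x = a" using assms by (intro exI[of _ "- a"]) auto
  qed
  then show ?thesis unfolding fun_class_def const_rel_def Image_singleton mem_Collect_eq prod.case
    by (rule Collect_cong)
qed

text \<open>A functional that kills \<open>one\<close> takes a single value on a class, so
  \<open>the_elem\<close> is applied to a singleton.\<close>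

lemma quot_pairing_cls:
  assumes "\<sigma> \<in> dual0 X evl"
  shows "quot_pairing \<sigma> (cls \<phi>) = blinfun_apply \<sigma> \<phi>"
proof -
  have "blinfun_apply \<sigma> \<psi> = blinfun_apply \<sigma> \<phi>" if \<psi>: "\<psi> \<in> cls \<phi>" for \<psi>
  proof -
    obtain c where "\<phi> - \<psi> = c *\<^sub>R one" using \<psi> unfolding Image_singleton_iff const_rel_iff by blast
    then have "blinfun_apply \<sigma> (\<phi> - \<psi>) = 0"
      using assms by (simp add: dual0_iff blinfun.scaleR_right)
    then show ?thesis by (simp add: blinfun.diff_right)
  qed
  moreover have "\<phi> \<in> cls \<phi>" using equiv_class_self[OF equiv_const_rel] by simp
  ultimately have "blinfun_apply \<sigma> ` cls \<phi> = {blinfun_apply \<sigma> \<phi>}" by blast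
  then show ?thesis by (simp add: quot_pairing_def)
qed

lemma id_minus_K2_cls: "id_minus_K2 X \<mu> k evl (cls \<phi>) = cls (A \<phi>)"
proof -
  have "cls (A \<psi>) = cls (A \<phi>)" if \<psi>: "\<psi> \<in> cls \<phi>" for \<psi>
  proof -
    obtain c where "\<phi> - \<psi> = c *\<^sub>R one" using \<psi> unfolding Image_singleton_iff const_rel_iff by blast
    then have "A \<phi> - A \<psi> = 0"
      by (simp add: linear_diff[OF linear_A, symmetric] linear_scale[OF linear_A] A_one)
    then show ?thesis by simp
  qed
  moreover have "\<phi> \<in> cls \<phi>" using equiv_class_self[OF equiv_const_rel] by simp
  ultimately have "(\<Union>\<psi>\<in>cls \<phi>. cls (A \<psi>)) = cls (A \<phi>)" by blast
  then show ?thesis by (simp only: id_minus_K2_def K_op_eq A_def)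
qed

lemma inj_on_id_minus_K2: "inj_on (id_minus_K2 X \<mu> k evl) (quot_space X evl)"
proof (rule inj_onI)
  fix C C' assume "C \<in> quot_space X evl" "C' \<in> quot_space X evl"
    and eq: "id_minus_K2 X \<mu> k evl C = id_minus_K2 X \<mu> k evl C'"
  then obtain \<phi> \<psi> where C: "C = cls \<phi>" "C' = cls \<psi>" by (auto simp: quot_space_eq)
  then have "\<exists>c. A (\<phi> - \<psi>) = c *\<^sub>R one"
    using eq by (simp add: id_minus_K2_cls cls_eq_iff linear_diff[OF linear_A])
  then show "C = C'" unfolding C cls_eq_iff using ker_A by blast
qed

lemma H_op_eq:
  assumes "\<And>\<phi>. blinfun_apply \<sigma> \<phi> = inner \<phi> h"
  shows "H_op X k evl \<sigma> = h"
  unfolding H_op_def kap_def[symmetric]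
  by (rule elem_of_eq) (simp add: assms inner_kap[symmetric] inner_commute)

text \<open>Any \<open>\<psi>\<close> for which \<open>A \<psi>\<close> represents
  \<open>\<tau>\<close> may replace the inverse operator, since the induced map is injective on
  classes. All later computations of the metric go through this.\<close>

lemma g_metric_eq:
  assumes "\<sigma> \<in> dual0 X evl" and "\<And>\<phi>. blinfun_apply \<tau> \<phi> = inner \<phi> (A \<psi>)"
  shows "g_metric \<epsilon> X \<mu> k evl \<sigma> \<tau> = \<epsilon> / 2 * blinfun_apply \<sigma> \<psi>"
proof -
  have "inv_into (quot_space X evl) (id_minus_K2 X \<mu> k evl) (cls (H_op X k evl \<tau>)) = cls \<psi>"
    using inv_into_f_f[OF inj_on_id_minus_K2, of "cls \<psi>"]
    by (simp add: H_op_eq[OF assms(2)] id_minus_K2_cls quot_space_eq)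
  then show ?thesis by (simp add: g_metric_def quot_pairing_cls assms(1))
qed

text \<open>Vanishing on \<open>one\<close> makes the Riesz vector orthogonal to \<open>one\<close>,
  which is the condition for \<open>A_surj\<close>.\<close>

lemma ex_preimage:
  assumes "\<sigma> \<in> dual0 X evl"
  shows "\<exists>\<psi>. \<forall>\<phi>. blinfun_apply \<sigma> \<phi> = inner \<phi> (A \<psi>)"
proof -
  obtain h where h: "\<And>\<phi>. blinfun_apply \<sigma> \<phi> = inner \<phi> h"
    using riesz_representation[OF blinfun.bounded_linear_right[of \<sigma>]] by blast
  then have "inner one h = 0" using assms by (simp add: dual0_iff)
  then show ?thesis using A_surj h by metis
qed

text \<open>Both sides are pairings of preimages through \<open>A\<close>, which is
  symmetric.\<close>

lemma g_metric_commute: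
  assumes "\<sigma> \<in> dual0 X evl" "\<tau> \<in> dual0 X evl"
  shows "g_metric \<epsilon> X \<mu> k evl \<sigma> \<tau> = g_metric \<epsilon> X \<mu> k evl \<tau> \<sigma>"
proof -
  obtain \<phi> where \<phi>: "\<And>\<theta>. blinfun_apply \<sigma> \<theta> = inner \<theta> (A \<phi>)" using ex_preimage assms(1) by blast
  obtain \<psi> where \<psi>: "\<And>\<theta>. blinfun_apply \<tau> \<theta> = inner \<theta> (A \<psi>)" using ex_preimage assms(2) by blast
  have "inner \<psi> (A \<phi>) = inner \<phi> (A \<psi>)"
    using A_symmetric[of \<phi> \<psi>] by (simp only: inner_commute)
  then show ?thesis
    by (simp only: g_metric_eq[OF assms(1) \<psi>] g_metric_eq[OF assms(2) \<phi>] \<phi> \<psi>)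
qed

lemma g_metric_diff_left:
  assumes "\<sigma> \<in> dual0 X evl" "\<sigma>' \<in> dual0 X evl" "\<tau> \<in> dual0 X evl"
  shows "g_metric \<epsilon> X \<mu> k evl (\<sigma> - \<sigma>') \<tau> = g_metric \<epsilon> X \<mu> k evl \<sigma> \<tau> - g_metric \<epsilon> X \<mu> k evl \<sigma>' \<tau>"
proof -
  obtain \<psi> where \<psi>: "\<And>\<theta>. blinfun_apply \<tau> \<theta> = inner \<theta> (A \<psi>)" using ex_preimage assms(3) by blast
  show ?thesis
    using assms by (simp add: g_metric_eq[OF _ \<psi>] diff_in_dual0 blinfun.diff_left right_diff_distrib)
qed

section \<open>Means, projection and orthogonal decomposition\<close>

lemma
  assumes "\<sigma> \<in> dual0 X evl"
  shows mean_vec_nth: "mean_vec X evl \<sigma> $ i = blinfun_apply \<sigma> (lin (axis i 1))"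
    and fun_class_coordinate: "fun_class X evl (\<lambda>x. x $ i) \<in> quot_space X evl"
proof -
  have "fun_class X evl (\<lambda>x. x $ i) = cls (lin (axis i 1))"
    by (rule fun_class_eq) (simp add: evl_lin inner_axis')
  then show "mean_vec X evl \<sigma> $ i = blinfun_apply \<sigma> (lin (axis i 1))"
    "fun_class X evl (\<lambda>x. x $ i) \<in> quot_space X evl"
    using assms by (simp_all add: mean_vec_def quot_pairing_cls quot_space_eq)
qed

text \<open>The Riesz vector of \<open>neg_div\<close> is already \<open>A\<close> applied to
  \<open>b *\<^sub>R lin v\<close>, so the inverse disappears and \<open>b = 2 / \<epsilon>\<close>
  cancels the prefactor of the metric.\<close>

lemma g_metric_neg_div:
  assumes "\<sigma> \<in> dual0 X evl"
  shows "g_metric \<epsilon> X \<mu> k evl \<sigma> (neg_div X \<mu> evl v) = inner (mean_vec X evl \<sigma>) v"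
proof -
  have "g_metric \<epsilon> X \<mu> k evl \<sigma> (neg_div X \<mu> evl v) = \<epsilon> / 2 * blinfun_apply \<sigma> (b *\<^sub>R lin v)"
    by (rule g_metric_eq[OF assms neg_div_lin])
  also have "\<dots> = blinfun_apply \<sigma> (lin v)"
    using eps_pos by (simp add: b_def blinfun.scaleR_right)
  also have "\<dots> = (\<Sum>i\<in>UNIV. v $ i * blinfun_apply \<sigma> (lin (axis i 1)))"
    by (subst lin_eq_sum) (simp add: blinfun.sum_right blinfun.scaleR_right)
  finally show ?thesis using assms by (simp add: inner_vec_def mean_vec_nth mult.commute)
qed

text \<open>Makes \<open>neg_div\<close> injective in \<open>v\<close>, and shows that subtracting
  \<open>neg_div\<close> at the mean leaves a functional of mean zero.\<close>

lemma mean_vec_neg_div: "mean_vec X evl (neg_div X \<mu> evl v) = v"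
  by (simp add: vec_eq_iff mean_vec_nth neg_div_in_dual0 neg_div_of_lin inner_axis)

lemma mean_vec_diff:
  assumes "\<sigma> \<in> dual0 X evl" "\<tau> \<in> dual0 X evl"
  shows "mean_vec X evl (\<sigma> - \<tau>) = mean_vec X evl \<sigma> - mean_vec X evl \<tau>"
  using assms by (simp add: vec_eq_iff mean_vec_nth diff_in_dual0 blinfun.diff_left)

lemma orth_proj_S_space:
  assumes "\<sigma> \<in> dual0 X evl"
  shows "orth_proj (g_metric \<epsilon> X \<mu> k evl) (S_space X \<mu> evl) \<sigma> = neg_div X \<mu> evl (mean_vec X evl \<sigma>)"
proof -
  have g: "g_metric \<epsilon> X \<mu> k evl (\<sigma> - neg_div X \<mu> evl w) (neg_div X \<mu> evl v)
      = inner (mean_vec X evl \<sigma> - w) v" for v w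
    using assms by (simp add: g_metric_neg_div diff_in_dual0 neg_div_in_dual0 mean_vec_diff mean_vec_neg_div)
  show ?thesis
    unfolding orth_proj_def
  proof (rule the_equality)
    fix \<tau>
    assume \<tau>: "\<tau> \<in> S_space X \<mu> evl \<and> (\<forall>\<rho>\<in>S_space X \<mu> evl. g_metric \<epsilon> X \<mu> k evl (\<sigma> - \<tau>) \<rho> = 0)"
    then obtain w where w: "\<tau> = neg_div X \<mu> evl w" by (auto simp: S_space_def)
    \<comment> \<open>The residual is tested in direction
      \<open>v = mean_vec X evl \<sigma> - w\<close>.\<close>
    have "inner (mean_vec X evl \<sigma> - w) (mean_vec X evl \<sigma> - w) = 0"
      using \<tau> unfolding w g[symmetric] S_space_def by blast
    then show "\<tau> = neg_div X \<mu> evl (mean_vec X evl \<sigma>)" by (simp add: w)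
  qed (auto simp: S_space_def g)
qed

lemma g_metric_pythagoras:
  assumes "\<sigma> \<in> dual0 X evl"
  defines "\<tau> \<equiv> neg_div X \<mu> evl (mean_vec X evl \<sigma>)"
  shows "g_metric \<epsilon> X \<mu> k evl \<sigma> \<sigma>
    = (norm (mean_vec X evl \<sigma>))\<^sup>2 + g_metric \<epsilon> X \<mu> k evl (\<sigma> - \<tau>) (\<sigma> - \<tau>)"
proof -
  let ?g = "g_metric \<epsilon> X \<mu> k evl"
  have \<tau>: "\<tau> \<in> dual0 X evl" "\<sigma> - \<tau> \<in> dual0 X evl"
    using assms neg_div_in_dual0 diff_in_dual0 by auto
  note \<sigma> = assms(1)
  \<comment> \<open>The metric against \<open>\<tau>\<close> sees only the mean, and
    \<open>\<sigma> - \<tau>\<close> has mean zero.\<close>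
  have "?g (\<sigma> - \<tau>) \<tau> = 0"
    using \<sigma> unfolding \<tau>_def
    by (simp add: g_metric_neg_div diff_in_dual0 neg_div_in_dual0 mean_vec_diff mean_vec_neg_div)
  moreover have "?g \<sigma> \<tau> = (norm (mean_vec X evl \<sigma>))\<^sup>2"
    using \<sigma> by (simp add: \<tau>_def g_metric_neg_div power2_norm_eq_inner)
  ultimately show ?thesis
    using g_metric_diff_left[OF \<sigma> \<tau>(1) \<tau>(2)] g_metric_diff_left[OF \<sigma> \<tau>(1) \<sigma>]
      g_metric_commute[OF \<tau>(1) \<tau>(2)] g_metric_commute[OF \<sigma> \<tau>(2)] g_metric_commute[OF \<tau>(1) \<sigma>]
    by linarith
qed

end

theorem proposition5p14:
  fixes U X :: "(real ^ 'n) set"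
    and \<epsilon> :: real
    and \<mu> :: "(real ^ 'n) measure"
    and f :: "real ^ 'n \<Rightarrow> real"
    and k :: "real ^ 'n \<Rightarrow> real ^ 'n \<Rightarrow> real"
    and evl :: "'h::{real_inner,complete_space} \<Rightarrow> real ^ 'n \<Rightarrow> real"
    and \<mu>' :: "'h \<Rightarrow>\<^sub>L real"
  assumes "open U" and "bounded U" and "X = closure U"
    and "\<epsilon> > 0"
    and "\<mu> \<in> prob_measures_on X"
    and "schroedinger_potential \<epsilon> X \<mu> f"
    and "k = gibbs_kernel \<epsilon> f"
    and "is_rkhs X k evl"
    and "\<mu>' \<in> dual0 X evl"
  shows "(\<forall>i. fun_class X evl (\<lambda>x. x $ i) \<in> quot_space X evl)
    \<and> (\<forall>m. orth_proj (g_metric \<epsilon> X \<mu> k evl) (S_space X \<mu> evl) \<mu>' = neg_div X \<mu> evl m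
             \<longleftrightarrow> m = mean_vec X evl \<mu>')
    \<and> g_metric \<epsilon> X \<mu> k evl \<mu>' \<mu>' =
        (norm (mean_vec X evl \<mu>'))\<^sup>2
        + g_metric \<epsilon> X \<mu> k evl (\<mu>' - neg_div X \<mu> evl (mean_vec X evl \<mu>'))
                             (\<mu>' - neg_div X \<mu> evl (mean_vec X evl \<mu>'))"
proof -
  interpret schroedinger_rkhs U X \<epsilon> \<mu> f k evl
    by unfold_locales (use assms in auto)
  \<comment> \<open>Injectivity of \<open>neg_div\<close> upgrades the projection formula to a
    characterisation of the mean.\<close>
  have "neg_div X \<mu> evl (mean_vec X evl \<mu>') = neg_div X \<mu> evl m \<longleftrightarrow> m = mean_vec X evl \<mu>'" for m
    by (metis mean_vec_neg_div)
  then show ?thesis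
    using assms(9) fun_class_coordinate[of \<mu>'] g_metric_pythagoras[of \<mu>'] orth_proj_S_space[of \<mu>']
    by simp
qed

end
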